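(* Let $f:[-\pi,\pi]\to[0,\infty)$ be a Lebesgue integrable function (a spectral density) whose support $S_f:=\{\lambda\in[-\pi,\pi]: f(\lambda)>0\}$ consists of a finite number (at least one) of intervals of the segment $[-\pi,\pi]$. Let $E_f:=\{e^{i\lambda}: \lambda\in S_f\}$ and let $\overline{E_f}$ be its closure. Then the sequence $\{\sqrt[n]{\sigma_n(f)}\}$ converges, and $$\lim_{n\to\infty}\sqrt[n]{\sigma_n(f)}=\tau(\overline{E_f}),$$ where $\tau(\overline{E_f})$ is the transfinite diameter of $\overline{E_f}$.
   Context: For a nonnegative integrable function $f$ on $[-\pi,\pi]$, $\sigma_n(f)\ge 0$ denotes the (finite-past, one-step ahead) prediction error, defined by $$\sigma_n^2(f)=\min_{q_n\in\mathcal Q_n}\int_{-\pi}^{\pi}|q_n(e^{i\lambda})|^2 f(\lambda)\,d\lambda,$$ where $\mathcal Q_n$ is the set of monic polynomials $q_n(z)=z^n+c_1z^{n-1}+\dots+c_n$ of degree $n$ with complex coefficients. For a compact set $F\subset\mathbb C$, the transfinite diameter is $\tau(F)=\lim_{n\to\infty} d_n(F)$, where $d_n(F)=\max_{z_1,\dots,z_n\in F}\left[\prod_{1\le j<k\le n}|z_j-z_k|\right]^{2/(n(n-1))}$. By the Fekete–Szegő theorem it equals the Chebyshev constant $\lim_{n\to\infty}\left(\inf_{q_n\in\mathcal Q_n}\max_{z\in F}|q_n(z)|\right)^{1/n}$ and the logarithmic capacity of $F$. *)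

theory Defs
  imports "HOL-Analysis.Analysis" "HOL-Computational_Algebra.Polynomial"
begin

definition monic_polys :: "nat \<Rightarrow> complex poly set" where
  "monic_polys n = {q. degree q = n \<and> lead_coeff q = 1}"

text \<open>
  The minimum over the monic polynomials of degree \<open>n\<close> is rendered as an infimum. It is attained
  whenever \<open>f\<close> is nonnegative and integrable on \<open>[-\<pi>, \<pi>]\<close>, the problem being a
  finite-dimensional least squares problem.
\<close>

definition prediction_error :: "nat \<Rightarrow> (real \<Rightarrow> real) \<Rightarrow> real" where
  "prediction_error n f =
     sqrt (INF q\<in>monic_polys n. LINT t:{-pi..pi}|lebesgue. (cmod (poly q (cis t)))\<^sup>2 * f t)"

text \<open>
  The supremum is attained for compact nonempty \<open>F\<close>. Only the values for \<open>n \<ge> 2\<close>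
  carry meaning, because the exponent is \<open>0\<close> by the convention \<open>x / 0 = 0\<close> for smaller \<open>n\<close>.
\<close>

definition diameter_of_order :: "nat \<Rightarrow> complex set \<Rightarrow> real" where
  "diameter_of_order n F =
     (SUP z\<in>{1..n} \<rightarrow> F.
        (\<Prod>k\<in>{1..n}. \<Prod>j\<in>{1..<k}. cmod (z j - z k)) powr (2 / (real n * (real n - 1))))"

text \<open>
  For compact nonempty \<open>F\<close> the sequence is nonincreasing from \<open>n = 2\<close> on and nonnegative, so the
  limit exists.
\<close>

definition transfinite_diameter :: "complex set \<Rightarrow> real" where
  "transfinite_diameter F = lim (\<lambda>n. diameter_of_order n F)"

text \<open>The set where \<open>f\<close> is positive; no closure is taken.\<close>

definition spectral_support :: "(real \<Rightarrow> real) \<Rightarrow> real set" where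
  "spectral_support f = {t \<in> {-pi..pi}. f t > 0}"

definition spectrum_on_circle :: "(real \<Rightarrow> real) \<Rightarrow> complex set" where
  "spectrum_on_circle f = cis ` spectral_support f"

end

theory Submission
  imports Defs "HOL-Real_Asymp.Real_Asymp"
begin

text \<open>
  Both sides equal the Chebyshev constant \<open>c\<close> of the closed spectrum. Leja points and the Lagrange
  interpolation formula for the leading coefficient show that the diameters tend to \<open>c\<close>, and
  polynomials that are small on the spectrum give the upper bound for the prediction error.

  For the lower bound, remove from the spectrum a set of small measure such that \<open>f\<close> is bounded below
  on the remaining set. By Markov's inequality a monic \<open>q\<close> of degree \<open>n\<close> satisfies \<open>|q| \<le> K\<close>, where
  \<open>K\<close> is a constant times the weighted norm of \<open>q\<close>, on a compact subset \<open>B\<close> whose complement in the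
  spectrum is still small. Pushing each of the arcs into \<open>B\<close> proportionally to measure shrinks no
  distance by more than a factor \<open>\<rho>\<close> close to 1. Therefore the Chebyshev constant of \<open>B\<close> is at least
  \<open>\<rho> c\<close>, so that \<open>K \<ge> (\<rho> c) ^ n\<close>.
\<close>

section \<open>Products and powers of monic polynomials\<close>

lemma monic_polys_mult:
  assumes "p \<in> monic_polys m" "q \<in> monic_polys n"
  shows "p * q \<in> monic_polys (m + n)"
proof -
  have "p \<noteq> 0" "q \<noteq> 0" using assms by (auto simp: monic_polys_def)
  then show ?thesis using assms lead_coeff_mult[of p q]
    by (auto simp: monic_polys_def degree_mult_eq)
qed

lemma one_in_monic_polys: "1 \<in> monic_polys 0"
  by (simp add: monic_polys_def)

lemma linear_in_monic_polys: "[:a, 1:] \<in> monic_polys 1"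
  by (simp add: monic_polys_def)

lemma monic_polys_power:
  assumes "p \<in> monic_polys m"
  shows "p ^ k \<in> monic_polys (k * m)"
proof (induction k)
  case 0
  show ?case by (simp add: one_in_monic_polys)
next
  case (Suc k)
  show ?case using monic_polys_mult[OF assms Suc.IH] by simp
qed

lemma monic_polys_prod_linear:
  assumes "finite A"
  shows "(\<Prod>a\<in>A. [:- g a, 1:]) \<in> monic_polys (card A)"
  using assms
proof (induction A rule: finite_induct)
  case empty
  show ?case by (simp add: one_in_monic_polys)
next
  case (insert x A)
  show ?case
    using monic_polys_mult[OF linear_in_monic_polys[of "- g x"] insert.IH] insert.hyps
    by (simp del: mult_pCons_left)
qed

lemma poly_prod_linear: "poly (\<Prod>a\<in>A. [:- g a, 1:]) z = (\<Prod>a\<in>A. z - (g a :: complex))"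
  by (simp add: poly_prod)

section \<open>The Chebyshev constant of subsets of the unit circle\<close>

definition cheb_bounds :: "complex set \<Rightarrow> real set" where
  "cheb_bounds F =
     {r. r > 0 \<and> (\<exists>m\<ge>1. \<exists>q\<in>monic_polys m. \<forall>z\<in>F. cmod (poly q z) \<le> r ^ m)}"

text \<open>An infimum over all degrees replaces the limit of the n-th roots, so that nothing has to
  converge. Requiring \<open>r > 0\<close> in \<open>cheb_bounds\<close> leaves this infimum
  unchanged and permits division by \<open>r\<close>.\<close>

definition chebyshev_constant :: "complex set \<Rightarrow> real" where
  "chebyshev_constant F = Inf (cheb_bounds F)"

lemma cheb_boundsI:
  assumes "r > 0" "m \<ge> 1" "q \<in> monic_polys m" "\<And>z. z \<in> F \<Longrightarrow> cmod (poly q z) \<le> r ^ m"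
  shows "r \<in> cheb_bounds F"
  using assms unfolding cheb_bounds_def by blast

lemma cheb_bounds_pos: "r \<in> cheb_bounds F \<Longrightarrow> r > 0"
  by (simp add: cheb_bounds_def)

lemma bdd_below_cheb_bounds: "bdd_below (cheb_bounds F)"
  by (rule bdd_belowI[of _ 0]) (simp add: cheb_bounds_def)

text \<open>The polynomial \<open>z\<close> has modulus 1 on the circle. Hence the infimum is taken
  over a nonempty set.\<close>

lemma one_in_cheb_bounds:
  assumes "F \<subseteq> sphere 0 1"
  shows "1 \<in> cheb_bounds F"
  using assms linear_in_monic_polys[of 0]
  by (intro cheb_boundsI[of _ 1 "[:0, 1:]"]) auto

lemma chebyshev_constant_le: "r \<in> cheb_bounds F \<Longrightarrow> chebyshev_constant F \<le> r"
  unfolding chebyshev_constant_def by (rule cInf_lower[OF _ bdd_below_cheb_bounds])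

lemma chebyshev_constant_nonneg:
  assumes "F \<subseteq> sphere 0 1"
  shows "chebyshev_constant F \<ge> 0"
  unfolding chebyshev_constant_def
  using one_in_cheb_bounds[OF assms] cheb_bounds_pos by (intro cInf_greatest) (auto intro: less_imp_le)

lemma cheb_bounds_approx:
  assumes "F \<subseteq> sphere 0 1" "chebyshev_constant F < x"
  obtains r where "r \<in> cheb_bounds F" "r < x"
  using assms one_in_cheb_bounds[OF assms(1)] bdd_below_cheb_bounds
  by (metis chebyshev_constant_def cInf_lessD empty_iff)

text \<open>Degrees that are not a multiple of that of the given polynomial are filled up with powers of
  \<open>z\<close>, which have modulus 1 on the circle.\<close>

lemma cheb_bounds_all_degrees:
  assumes "F \<subseteq> sphere 0 1" "r \<in> cheb_bounds F"
  obtains D where "D \<ge> 1" "\<And>k. \<exists>q\<in>monic_polys k. \<forall>z\<in>F. cmod (poly q z) \<le> D * r ^ k"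
proof -
  obtain m q where r: "r > 0" and m: "m \<ge> 1" and q: "q \<in> monic_polys m"
    and bound: "\<And>z. z \<in> F \<Longrightarrow> cmod (poly q z) \<le> r ^ m"
    using assms(2) unfolding cheb_bounds_def by blast
  \<comment> \<open>Each of the \<open>k mod m\<close> filling factors has modulus 1 instead of
    \<open>r\<close>, which costs a factor \<open>1 / r\<close>; fewer than \<open>m\<close> of them
    occur.\<close>
  define D where "D = max 1 (1 / r) ^ m"
  have "\<exists>p\<in>monic_polys k. \<forall>z\<in>F. cmod (poly p z) \<le> D * r ^ k" for k
  proof (intro bexI ballI)
    show "q ^ (k div m) * [:0, 1:] ^ (k mod m) \<in> monic_polys k"
      using monic_polys_mult[OF monic_polys_power[OF q, of "k div m"]
          monic_polys_power[OF linear_in_monic_polys[of 0], of "k mod m"]] by simp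
    fix z assume z: "z \<in> F"
    have "cmod z = 1" using z assms(1) by auto
    then have "cmod (poly (q ^ (k div m) * [:0, 1:] ^ (k mod m)) z) = cmod (poly q z) ^ (k div m)"
      by (simp add: norm_mult norm_power)
    also have "\<dots> \<le> (r ^ m) ^ (k div m)"
      by (intro power_mono bound z) auto
    also have "\<dots> = (1 / r) ^ (k mod m) * r ^ k"
    proof -
      have "r ^ k = r ^ (m * (k div m)) * r ^ (k mod m)"
        by (simp flip: power_add)
      then show ?thesis using r by (simp add: power_divide power_mult)
    qed
    also have "\<dots> \<le> D * r ^ k"
    proof (rule mult_right_mono)
      have "(1 / r) ^ (k mod m) \<le> max 1 (1 / r) ^ (k mod m)"
        using r by (intro power_mono) auto
      also have "\<dots> \<le> D"
        unfolding D_def using m by (intro power_increasing) (auto intro: less_imp_le)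
      finally show "(1 / r) ^ (k mod m) \<le> D" .
    qed (use r in auto)
    finally show "cmod (poly (q ^ (k div m) * [:0, 1:] ^ (k mod m)) z) \<le> D * r ^ k" .
  qed
  moreover have "D \<ge> 1" unfolding D_def by (intro one_le_power) auto
  ultimately show ?thesis using that by blast
qed

lemma geometric_eventually_dominates:
  fixes a b C :: real
  assumes "0 < a" "a < b"
  shows "\<forall>\<^sub>F k in sequentially. C * a ^ k \<le> b ^ k"
proof -
  have "(\<lambda>k. C * (a / b) ^ k) \<longlonglongrightarrow> C * 0"
    using assms by (intro tendsto_mult tendsto_const LIMSEQ_power_zero) auto
  then have "\<forall>\<^sub>F k in sequentially. C * (a / b) ^ k < 1"
    by (intro order_tendstoD) auto
  then show ?thesis
    by eventually_elim (use assms in \<open>auto simp: power_divide field_simps\<close>)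
qed

text \<open>Finitely many points cost only finitely many linear factors, each bounded by 2 on the circle.\<close>

lemma chebyshev_constant_Un_finite:
  assumes "F \<subseteq> sphere 0 1" "P \<subseteq> sphere 0 1" "finite P"
  shows "chebyshev_constant (F \<union> P) \<le> chebyshev_constant F"
proof (rule dense_ge)
  fix x assume "chebyshev_constant F < x"
  then obtain r where r: "r \<in> cheb_bounds F" "r < x" using cheb_bounds_approx assms by blast
  have r0: "r > 0" using r cheb_bounds_pos by blast
  obtain D where D: "D \<ge> 1" "\<And>k. \<exists>q\<in>monic_polys k. \<forall>z\<in>F. cmod (poly q z) \<le> D * r ^ k"
    using cheb_bounds_all_degrees[OF assms(1) r(1)] by blast
  let ?s = "card P"
  \<comment> \<open>Dividing by \<open>x ^ card P\<close> accounts for the degree, which rises from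
    \<open>k\<close> to \<open>k + card P\<close>.\<close>
  have "\<forall>\<^sub>F k in sequentially. (2 ^ ?s * D / x ^ ?s) * r ^ k \<le> x ^ k"
    using r0 r by (intro geometric_eventually_dominates) auto
  then have "\<forall>\<^sub>F k in sequentially. k \<ge> 1 \<and> (2 ^ ?s * D / x ^ ?s) * r ^ k \<le> x ^ k"
    using eventually_ge_at_top[of 1] by eventually_elim auto
  then obtain k where k: "k \<ge> 1" "(2 ^ ?s * D / x ^ ?s) * r ^ k \<le> x ^ k"
    using eventually_sequentially by auto
  obtain q where q: "q \<in> monic_polys k" "\<And>z. z \<in> F \<Longrightarrow> cmod (poly q z) \<le> D * r ^ k"
    using D(2) by blast
  have "x \<in> cheb_bounds (F \<union> P)"
  proof (rule cheb_boundsI)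
    show "q * (\<Prod>a\<in>P. [:- a, 1:]) \<in> monic_polys (k + ?s)"
      by (intro monic_polys_mult q monic_polys_prod_linear assms)
    fix z assume z: "z \<in> F \<union> P"
    show "cmod (poly (q * (\<Prod>a\<in>P. [:- a, 1:])) z) \<le> x ^ (k + ?s)"
    proof (cases "z \<in> P")
      case True
      then have "(\<Prod>a\<in>P. z - a) = 0" using assms(3) by (auto intro!: prod_zero)
      then show ?thesis using r0 r by (simp add: poly_prod_linear[where g="\<lambda>a. a"])
    next
      case False
      then have zF: "z \<in> F" using z by blast
      have "cmod (\<Prod>a\<in>P. z - a) = (\<Prod>a\<in>P. cmod (z - a))" by (simp add: prod_norm)
      also have "\<dots> \<le> (\<Prod>a\<in>P. 2)"
      proof (rule prod_mono)
        fix a assume "a \<in> P"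
        then have "cmod a = 1" "cmod z = 1" using assms zF by auto
        then show "0 \<le> cmod (z - a) \<and> cmod (z - a) \<le> 2"
          using norm_triangle_ineq4[of z a] by simp
      qed
      finally have le2: "cmod (\<Prod>a\<in>P. z - a) \<le> 2 ^ ?s" by simp
      have "cmod (poly (q * (\<Prod>a\<in>P. [:- a, 1:])) z) = cmod (poly q z) * cmod (\<Prod>a\<in>P. z - a)"
        by (simp add: poly_prod_linear[where g="\<lambda>a. a"] norm_mult)
      also have "\<dots> \<le> (D * r ^ k) * 2 ^ ?s"
        by (intro mult_mono q zF le2) (use D r0 in auto)
      also have "\<dots> \<le> x ^ k * x ^ ?s"
        using k(2) r r0 by (simp add: field_simps)
      finally show ?thesis by (simp add: power_add)
    qed
  qed (use k r r0 in auto)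
  then show "chebyshev_constant (F \<union> P) \<le> x" by (rule chebyshev_constant_le)
qed

lemma chebyshev_constant_mono:
  assumes "F \<subseteq> G" "G \<subseteq> sphere 0 1"
  shows "chebyshev_constant F \<le> chebyshev_constant G"
  unfolding chebyshev_constant_def
proof (rule cInf_superset_mono[OF _ bdd_below_cheb_bounds])
  show "cheb_bounds G \<noteq> {}" using one_in_cheb_bounds[OF assms(2)] by blast
  show "cheb_bounds G \<subseteq> cheb_bounds F" unfolding cheb_bounds_def using assms(1) by blast
qed

text \<open>The condition on \<open>q\<close> is vacuous, so every positive \<open>r\<close> is a
  bound. An empty family of arcs occurs when the support consists of finitely many points.\<close>

lemma chebyshev_constant_empty: "chebyshev_constant {} = 0"
proof (rule antisym)
  show "chebyshev_constant {} \<le> 0"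
  proof (rule dense_ge)
    fix x :: real assume "0 < x"
    then have "x \<in> cheb_bounds {}"
      by (intro cheb_boundsI[of _ 1 "[:0, 1:]"]) (auto simp: monic_polys_def)
    then show "chebyshev_constant {} \<le> x" by (rule chebyshev_constant_le)
  qed
qed (simp add: chebyshev_constant_nonneg)

subsection \<open>Transfinite diameter and Chebyshev constant\<close>

text \<open>The modulus of the Vandermonde determinant of the first \<open>n\<close> points.
  Counting from 0 gives index \<open>k\<close> exactly \<open>k\<close> factors, so that a new point
  \<open>z n\<close> contributes one more inner product.\<close>

definition vandermonde :: "nat \<Rightarrow> (nat \<Rightarrow> complex) \<Rightarrow> real" where
  "vandermonde n z = (\<Prod>k<n. \<Prod>j<k. cmod (z j - z k))"

lemma vandermonde_nonneg: "vandermonde n z \<ge> 0"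
  unfolding vandermonde_def by (intro prod_nonneg) auto

text \<open>Choosing points in succession by this lemma produces a Leja sequence.\<close>

lemma exists_far_point:
  assumes "compact F" "F \<noteq> {}" "F \<subseteq> sphere 0 1"
  shows "\<exists>x\<in>F. (\<Prod>j<k. cmod (w j - x)) \<ge> chebyshev_constant F ^ k"
proof (cases "k = 0")
  case True
  then show ?thesis using assms by auto
next
  case False
  let ?g = "\<lambda>x. \<Prod>j<k. cmod (w j - x)"
  have "continuous_on F ?g" by (intro continuous_intros)
  then obtain x where x: "x \<in> F" "\<And>y. y \<in> F \<Longrightarrow> ?g y \<le> ?g x"
    using continuous_attains_sup[OF assms(1,2)] by metis
  have "?g x \<ge> chebyshev_constant F ^ k"
  proof (rule ccontr)
    assume "\<not> ?thesis"
    then have less: "?g x < chebyshev_constant F ^ k" by simp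
    have g0: "?g x \<ge> 0" by (intro prod_nonneg) auto
    \<comment> \<open>The power \<open>r ^ k\<close> is the midpoint between the maximum and the
      supposed larger value: it is positive even if the maximum is 0, bounds the product polynomial
      on \<open>F\<close>, and is still below the k-th power of the Chebyshev constant.\<close>
    define r where "r = root k ((?g x + chebyshev_constant F ^ k) / 2)"
    have rk: "r ^ k = (?g x + chebyshev_constant F ^ k) / 2"
      unfolding r_def using False less g0 by (intro real_root_pow_pos2) auto
    have "r > 0" unfolding r_def using False less g0 by (subst real_root_gt_0_iff) auto
    moreover have "cmod (poly (\<Prod>j<k. [:- w j, 1:]) y) \<le> r ^ k" if "y \<in> F" for y
    proof -
      have "cmod (poly (\<Prod>j<k. [:- w j, 1:]) y) = ?g y"
        by (simp add: poly_prod_linear norm_minus_commute flip: prod_norm)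
      then show ?thesis using x(2)[OF that] less rk by simp
    qed
    ultimately have "r \<in> cheb_bounds F"
      using False monic_polys_prod_linear[of "{..<k}" w]
      by (intro cheb_boundsI[of r k "\<Prod>j<k. [:- w j, 1:]"]) auto
    then have "chebyshev_constant F \<le> r" by (rule chebyshev_constant_le)
    then have "chebyshev_constant F ^ k \<le> r ^ k"
      by (intro power_mono chebyshev_constant_nonneg assms)
    then show False using rk less by simp
  qed
  then show ?thesis using x by blast
qed

text \<open>The choice is greedy: storing the far point at index \<open>n\<close> leaves all earlier
  factors unchanged and adds a factor of at least the n-th power of the Chebyshev constant.\<close>

lemma vandermonde_lower:
  assumes "compact F" "F \<noteq> {}" "F \<subseteq> sphere 0 1"
  shows "\<exists>w. (\<forall>k. w k \<in> F) \<and> vandermonde n w \<ge> (\<Prod>k<n. chebyshev_constant F ^ k)"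
proof (induction n)
  case 0
  obtain x where "x \<in> F" using assms by blast
  then show ?case by (intro exI[of _ "\<lambda>_. x"]) (simp add: vandermonde_def)
next
  case (Suc n)
  then obtain w where w: "\<And>k. w k \<in> F" "vandermonde n w \<ge> (\<Prod>k<n. chebyshev_constant F ^ k)"
    by blast
  obtain x where x: "x \<in> F" "(\<Prod>j<n. cmod (w j - x)) \<ge> chebyshev_constant F ^ n"
    using exists_far_point[OF assms] by blast
  have "vandermonde n (w(n := x)) = vandermonde n w"
    unfolding vandermonde_def by (intro prod.cong) auto
  then have eq: "vandermonde (Suc n) (w(n := x)) = vandermonde n w * (\<Prod>j<n. cmod (w j - x))"
    unfolding vandermonde_def by simp
  have "(\<Prod>k<Suc n. chebyshev_constant F ^ k) =
      (\<Prod>k<n. chebyshev_constant F ^ k) * chebyshev_constant F ^ n" by simp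
  also have "\<dots> \<le> vandermonde n w * (\<Prod>j<n. cmod (w j - x))"
    by (intro mult_mono w x) (use vandermonde_nonneg chebyshev_constant_nonneg[OF assms(3)] in auto)
  finally have "(\<Prod>k<Suc n. chebyshev_constant F ^ k) \<le> vandermonde (Suc n) (w(n := x))"
    using eq by simp
  moreover have "\<forall>k. (w(n := x)) k \<in> F" using w x by simp
  ultimately show ?case by blast
qed

section \<open>Upper bounds for Vandermonde products by interpolation\<close>

text \<open>Compare the coefficients of \<open>z ^ n\<close> in the Lagrange interpolation of
  \<open>q\<close> at \<open>n + 1\<close> nodes: each numerator \<open>L z\<close> is monic of
  degree \<open>n\<close>.\<close>

lemma lagrange_lead_coeff:
  fixes q :: "complex poly"
  assumes "finite Z" "q \<in> monic_polys n" "card Z = Suc n"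
  shows "(\<Sum>z\<in>Z. poly q z / (\<Prod>w\<in>Z - {z}. z - w)) = 1"
proof -
  define L where "L = (\<lambda>z. \<Prod>w\<in>Z - {z}. [:- w, 1:])"
  define p where "p = (\<Sum>z\<in>Z. smult (poly q z / (\<Prod>w\<in>Z - {z}. z - w)) (L z))"
  have L: "L z \<in> monic_polys n" if "z \<in> Z" for z
    using monic_polys_prod_linear[of "Z - {z}" "\<lambda>w. w"] assms that unfolding L_def by simp
  have "p = q"
  proof (rule poly_eqI_degree[of Z])
    fix x assume x: "x \<in> Z"
    have nz: "(\<Prod>w\<in>Z - {x}. x - w) \<noteq> 0" using assms(1) by auto
    have "poly p x = (\<Sum>z\<in>Z. poly q z / (\<Prod>w\<in>Z - {z}. z - w) * (\<Prod>w\<in>Z - {z}. x - w))"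
      unfolding p_def L_def by (simp add: poly_sum poly_prod_linear[where g="\<lambda>w. w"])
    also have "\<dots> = (\<Sum>z\<in>Z. if z = x then poly q x else 0)"
    proof (rule sum.cong)
      fix z assume "z \<in> Z"
      show "poly q z / (\<Prod>w\<in>Z - {z}. z - w) * (\<Prod>w\<in>Z - {z}. x - w) = (if z = x then poly q x else 0)"
      proof (cases "z = x")
        case True then show ?thesis using nz by simp
      next
        case False
        then have "(\<Prod>w\<in>Z - {z}. x - w) = 0"
          using x assms(1) by (intro prod_zero) auto
        then show ?thesis using False by simp
      qed
    qed auto
    finally show "poly p x = poly q x" using x assms(1) by simp
  next
    have "degree p \<le> n" unfolding p_def
    proof (rule degree_sum_le[OF assms(1)])
      fix z assume "z \<in> Z"
      then have "degree (L z) = n" using L by (auto simp: monic_polys_def)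
      then show "degree (smult (poly q z / (\<Prod>w\<in>Z - {z}. z - w)) (L z)) \<le> n"
        using degree_smult_le order_trans by blast
    qed
    then show "degree p < card Z" using assms by simp
    show "degree q < card Z" using assms by (simp add: monic_polys_def)
  qed
  then have "1 = coeff p n" using assms(2) by (auto simp: monic_polys_def)
  also have "\<dots> = (\<Sum>z\<in>Z. poly q z / (\<Prod>w\<in>Z - {z}. z - w) * coeff (L z) n)"
    unfolding p_def by (simp add: coeff_sum)
  also have "\<dots> = (\<Sum>z\<in>Z. poly q z / (\<Prod>w\<in>Z - {z}. z - w))"
    using L by (intro sum.cong) (auto simp: monic_polys_def)
  finally show ?thesis by simp
qed

text \<open>Otherwise each term of the Lagrange sum would have modulus below
  \<open>1 / (n + 1)\<close>, although the sum is 1.\<close>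

lemma exists_crowded_point:
  assumes "finite Z" "q \<in> monic_polys n" "card Z = Suc n" "\<And>z. z \<in> Z \<Longrightarrow> cmod (poly q z) \<le> b"
  shows "\<exists>z\<in>Z. (\<Prod>w\<in>Z - {z}. cmod (z - w)) \<le> real (Suc n) * b"
proof (rule ccontr)
  assume "\<not> ?thesis"
  then have gt: "real (Suc n) * b < (\<Prod>w\<in>Z - {z}. cmod (z - w))" if "z \<in> Z" for z
    using that by force
  have ne: "Z \<noteq> {}" using assms by auto
  have b0: "b \<ge> 0" using assms(4) ne norm_ge_zero order_trans by blast
  have pos: "(\<Prod>w\<in>Z - {z}. cmod (z - w)) > 0" for z using assms(1) by (intro prod_pos) auto
  have "1 = cmod (\<Sum>z\<in>Z. poly q z / (\<Prod>w\<in>Z - {z}. z - w))"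
    using lagrange_lead_coeff[OF assms(1-3)] by simp
  also have "\<dots> \<le> (\<Sum>z\<in>Z. cmod (poly q z) / (\<Prod>w\<in>Z - {z}. cmod (z - w)))"
    by (rule order_trans[OF norm_sum]) (simp add: norm_divide prod_norm)
  also have "\<dots> < (\<Sum>z\<in>Z. 1 / real (Suc n))"
  proof (rule sum_strict_mono[OF assms(1) ne])
    fix z assume z: "z \<in> Z"
    have "real (Suc n) * cmod (poly q z) \<le> real (Suc n) * b"
      using assms(4)[OF z] by (intro mult_left_mono) auto
    also have "\<dots> < (\<Prod>w\<in>Z - {z}. cmod (z - w))" by (rule gt[OF z])
    finally show "cmod (poly q z) / (\<Prod>w\<in>Z - {z}. cmod (z - w)) < 1 / real (Suc n)"
      using pos[of z] by (simp add: field_simps)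
  qed
  also have "\<dots> = 1" using assms(3) by simp
  finally show False by simp
qed

text \<open>Ordered pairs are multiplied, so for finite \<open>Z\<close> this is the square of the
  Vandermonde product, the modulus of the discriminant of the monic polynomial with roots
  \<open>Z\<close>. Indexing by a set lets any point be removed without renumbering.\<close>

definition discriminant :: "complex set \<Rightarrow> real" where
  "discriminant Z = (\<Prod>z\<in>Z. \<Prod>w\<in>Z - {z}. cmod (z - w))"

lemma discriminant_insert:
  assumes "finite Z" "x \<notin> Z"
  shows "discriminant (insert x Z) = discriminant Z * (\<Prod>w\<in>Z. cmod (x - w))\<^sup>2"
proof -
  have "discriminant (insert x Z) =
      (\<Prod>w\<in>Z. cmod (x - w)) * (\<Prod>z\<in>Z. \<Prod>w\<in>insert x Z - {z}. cmod (z - w))"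
    unfolding discriminant_def using assms by simp
  also have "(\<Prod>z\<in>Z. \<Prod>w\<in>insert x Z - {z}. cmod (z - w)) =
      (\<Prod>z\<in>Z. cmod (x - z) * (\<Prod>w\<in>Z - {z}. cmod (z - w)))"
  proof (rule prod.cong)
    fix z assume "z \<in> Z"
    then have "insert x Z - {z} = insert x (Z - {z})" using assms by auto
    then show "(\<Prod>w\<in>insert x Z - {z}. cmod (z - w)) = cmod (x - z) * (\<Prod>w\<in>Z - {z}. cmod (z - w))"
      using assms by (simp add: norm_minus_commute)
  qed auto
  finally show ?thesis by (simp add: prod.distrib discriminant_def power2_eq_square)
qed

text \<open>Removing a crowded point lowers the cardinality by one and costs the factor
  \<open>((n + 1) b n)\<^sup>2\<close>, so no determinant is needed.\<close>

lemma discriminant_le: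
  assumes "finite Z" "\<And>k. \<exists>q\<in>monic_polys k. \<forall>z\<in>Z. cmod (poly q z) \<le> b k"
  shows "discriminant Z \<le> (\<Prod>k<card Z. real (Suc k) * b k)\<^sup>2"
  using assms
proof (induction "card Z" arbitrary: Z)
  case 0
  then show ?case by (simp add: discriminant_def)
next
  case (Suc n)
  obtain q where q: "q \<in> monic_polys n" "\<And>z. z \<in> Z \<Longrightarrow> cmod (poly q z) \<le> b n"
    using Suc.prems(2) by blast
  obtain x where x: "x \<in> Z" "(\<Prod>w\<in>Z - {x}. cmod (x - w)) \<le> real (Suc n) * b n"
    using exists_crowded_point[OF Suc.prems(1) q(1) Suc.hyps(2)[symmetric] q(2)] by blast
  let ?Y = "Z - {x}"
  have cY: "card ?Y = n" using Suc.hyps(2) x Suc.prems(1) by simp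
  have IH: "discriminant ?Y \<le> (\<Prod>k<n. real (Suc k) * b k)\<^sup>2"
    using Suc.hyps(1)[of ?Y] cY Suc.prems by (metis DiffD1 finite_Diff)
  have "discriminant Z = discriminant ?Y * (\<Prod>w\<in>?Y. cmod (x - w))\<^sup>2"
    using discriminant_insert[of ?Y x] Suc.prems(1) x by (simp add: insert_absorb)
  also have "\<dots> \<le> (\<Prod>k<n. real (Suc k) * b k)\<^sup>2 * (real (Suc n) * b n)\<^sup>2"
    using x by (intro mult_mono IH power_mono prod_nonneg) auto
  also have "\<dots> = (\<Prod>k<card Z. real (Suc k) * b k)\<^sup>2"
    by (simp flip: Suc.hyps(2) add: power_mult_distrib)
  finally show ?case .
qed

lemma vandermonde_eq_discriminant:
  assumes "inj_on z {..<n}"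
  shows "(vandermonde n z)\<^sup>2 = discriminant (z ` {..<n})"
  using assms
proof (induction n)
  case 0
  then show ?case by (simp add: vandermonde_def discriminant_def)
next
  case (Suc n)
  have inj: "inj_on z {..<n}" using Suc.prems by (rule inj_on_subset) auto
  have "z n \<notin> z ` {..<n}" using Suc.prems by (simp add: lessThan_Suc)
  then have "discriminant (z ` {..<Suc n}) =
      discriminant (z ` {..<n}) * (\<Prod>w\<in>z ` {..<n}. cmod (z n - w))\<^sup>2"
    by (simp add: lessThan_Suc discriminant_insert)
  also have "(\<Prod>w\<in>z ` {..<n}. cmod (z n - w)) = (\<Prod>j<n. cmod (z j - z n))"
    by (simp add: prod.reindex[OF inj] norm_minus_commute)
  finally show ?case using Suc.IH[OF inj] by (simp add: vandermonde_def power_mult_distrib)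
qed

lemma vandermonde_not_inj:
  assumes "\<not> inj_on z {..<n}"
  shows "vandermonde n z = 0"
proof -
  obtain i j where "i < n" "j < n" "i < j" "z i = z j"
    using assms by (auto simp: inj_on_def) (metis linorder_neqE_nat)
  then have "(\<Prod>i<j. cmod (z i - z j)) = 0"
    by (intro prod_zero) auto
  then show ?thesis unfolding vandermonde_def using \<open>j < n\<close> by (intro prod_zero) auto
qed

text \<open>Distinct points reduce to the version for sets; a repeated point makes the product
  vanish.\<close>

lemma vandermonde_le:
  assumes "\<And>k. \<exists>q\<in>monic_polys k. \<forall>z\<in>F. cmod (poly q z) \<le> b k" "\<And>k. k < n \<Longrightarrow> z k \<in> F"
    "\<And>k. b k \<ge> 0"
  shows "vandermonde n z \<le> (\<Prod>k<n. real (Suc k) * b k)"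
proof (cases "inj_on z {..<n}")
  case True
  have "(vandermonde n z)\<^sup>2 = discriminant (z ` {..<n})" by (rule vandermonde_eq_discriminant[OF True])
  also have "\<dots> \<le> (\<Prod>k<card (z ` {..<n}). real (Suc k) * b k)\<^sup>2"
  proof (rule discriminant_le)
    fix k
    show "\<exists>q\<in>monic_polys k. \<forall>z\<in>z ` {..<n}. cmod (poly q z) \<le> b k"
      using assms(1)[of k] assms(2) by blast
  qed auto
  also have "card (z ` {..<n}) = n" by (simp add: card_image[OF True])
  finally show ?thesis
    by (rule power2_le_imp_le) (use assms(3) in \<open>simp add: prod_nonneg\<close>)
next
  case False
  then show ?thesis using assms(3) by (simp add: vandermonde_not_inj prod_nonneg)
qed

lemma prod_power_lessThan: "(\<Prod>k<n. (c::real) ^ k)\<^sup>2 = c ^ (n * (n - 1))"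
proof (induction n)
  case (Suc n)
  have "(\<Prod>k<Suc n. c ^ k)\<^sup>2 = (\<Prod>k<n. c ^ k)\<^sup>2 * c ^ (n * 2)"
    by (simp only: prod.lessThan_Suc power_mult_distrib power_mult)
  also have "\<dots> = c ^ (n * (n - 1) + n * 2)" by (simp only: Suc.IH power_add)
  also have "n * (n - 1) + n * 2 = Suc n * (Suc n - 1)" by (cases n) auto
  finally show ?case .
qed simp

text \<open>The constants multiply to at most \<open>(n * D) ^ n\<close>. This is negligible against
  the powers of \<open>r\<close>, whose exponents add up to \<open>n * (n - 1) / 2\<close>.\<close>

lemma vandermonde_le_cheb_bound:
  assumes "F \<subseteq> sphere 0 1" "r \<in> cheb_bounds F"
  obtains D where "D \<ge> 1"
    "\<And>n z. (\<And>k. k < n \<Longrightarrow> z k \<in> F) \<Longrightarrow> vandermonde n z \<le> (real n * D) ^ n * (\<Prod>k<n. r ^ k)"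
proof -
  obtain D where D: "D \<ge> 1" "\<And>k. \<exists>q\<in>monic_polys k. \<forall>z\<in>F. cmod (poly q z) \<le> D * r ^ k"
    using cheb_bounds_all_degrees[OF assms] by blast
  have r: "r > 0" using assms cheb_bounds_pos by blast
  have "vandermonde n z \<le> (real n * D) ^ n * (\<Prod>k<n. r ^ k)" if "\<And>k. k < n \<Longrightarrow> z k \<in> F" for n z
  proof -
    have "vandermonde n z \<le> (\<Prod>k<n. real (Suc k) * (D * r ^ k))"
      using D r that by (intro vandermonde_le[where F=F]) auto
    also have "\<dots> \<le> (\<Prod>k<n. (real n * D) * r ^ k)"
    proof (rule prod_mono)
      fix k assume "k \<in> {..<n}"
      then have "real (Suc k) * (D * r ^ k) \<le> real n * (D * r ^ k)"
        using D r by (intro mult_right_mono) auto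
      then show "0 \<le> real (Suc k) * (D * r ^ k) \<and> real (Suc k) * (D * r ^ k) \<le> (real n * D) * r ^ k"
        using D r by (simp add: mult.assoc)
    qed
    finally show ?thesis by (simp add: prod.distrib)
  qed
  then show ?thesis using that D(1) by blast
qed

text \<open>If \<open>r < a\<close>, the power of \<open>a / r\<close> with exponent
  \<open>n * (n - 1) / 2\<close> would outgrow \<open>(n * D) ^ n\<close>. This turns configurations
  of points with large products into lower bounds for the Chebyshev constant.\<close>

lemma le_cheb_bound:
  assumes "F \<subseteq> sphere 0 1" "r \<in> cheb_bounds F" "a \<ge> 0"
    and "\<And>n. \<exists>z. (\<forall>k<n. z k \<in> F) \<and> vandermonde n z \<ge> (\<Prod>k<n. a ^ k)"
  shows "a \<le> r"
proof (rule ccontr)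
  assume "\<not> a \<le> r"
  then have ar: "r < a" by simp
  have r: "r > 0" using assms cheb_bounds_pos by blast
  obtain D where D: "D \<ge> 1"
    "\<And>n z. (\<And>k. k < n \<Longrightarrow> z k \<in> F) \<Longrightarrow> vandermonde n z \<le> (real n * D) ^ n * (\<Prod>k<n. r ^ k)"
    using vandermonde_le_cheb_bound[OF assms(1,2)] by blast
  define x where "x = a / r"
  have x: "x > 1" unfolding x_def using ar r by simp
  \<comment> \<open>With \<open>Suc n\<close> points the squared products have exponent
    \<open>Suc n * n\<close>. The root of order \<open>Suc n\<close> then leaves an exponential on
    the left and a polynomial in \<open>n\<close> on the right.\<close>
  have *: "x ^ n \<le> (real (Suc n) * D)\<^sup>2" for n
  proof -
    let ?m = "Suc n"
    obtain z where z: "\<forall>k<?m. z k \<in> F" "vandermonde ?m z \<ge> (\<Prod>k<?m. a ^ k)"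
      using assms(4) by blast
    have "(\<Prod>k<?m. a ^ k) \<le> (real ?m * D) ^ ?m * (\<Prod>k<?m. r ^ k)"
      using z D(2)[of ?m z] by (meson order_trans)
    then have "(\<Prod>k<?m. a ^ k)\<^sup>2 \<le> ((real ?m * D) ^ ?m * (\<Prod>k<?m. r ^ k))\<^sup>2"
      using assms(3) by (intro power_mono prod_nonneg) auto
    then have "a ^ (?m * n) \<le> ((real ?m * D)\<^sup>2) ^ ?m * r ^ (?m * n)"
      unfolding power_mult_distrib[of "_ ^ _" "prod _ _"] prod_power_lessThan
      by (metis diff_Suc_1 mult.commute power_mult)
    then have "x ^ (?m * n) \<le> ((real ?m * D)\<^sup>2) ^ ?m"
      unfolding x_def using r by (simp only: power_divide divide_le_eq zero_less_power) auto
    then have "(x ^ n) ^ ?m \<le> ((real ?m * D)\<^sup>2) ^ ?m"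
      by (metis mult.commute power_mult)
    then show ?thesis by (rule power_le_imp_le_base) simp
  qed
  have "\<forall>\<^sub>F n in sequentially. (real (Suc n) * D)\<^sup>2 < x ^ n"
    using x D(1) by real_asymp
  then obtain n where "(real (Suc n) * D)\<^sup>2 < x ^ n"
    by (auto simp: eventually_sequentially)
  then show False using *[of n] by simp
qed

text \<open>Shifting the index by one maps the first space of functions onto the second, since both
  leave the values outside the index range free.\<close>

lemma diameter_of_order_eq:
  assumes "n \<ge> 2"
  shows "diameter_of_order n F =
     (SUP z\<in>{z. \<forall>k<n. z k \<in> F}. vandermonde n z powr (2 / (real n * (real n - 1))))"
proof -
  have v: "(\<Prod>k\<in>{1..n}. \<Prod>j\<in>{1..<k}. cmod (z j - z k)) = vandermonde n (\<lambda>k. z (Suc k))" for z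
    unfolding vandermonde_def One_nat_def prod.atLeast1_atMost_eq
    by (simp only: prod.atLeast_Suc_lessThan_Suc_shift atLeast0LessThan o_def)
  have "(\<lambda>z k. z (Suc k)) ` ({1..n} \<rightarrow> F) = {z. \<forall>k<n. z k \<in> F}"
  proof (intro equalityI subsetI)
    fix z assume "z \<in> {z. \<forall>k<n. z k \<in> F}"
    then show "z \<in> (\<lambda>z k. z (Suc k)) ` ({1..n} \<rightarrow> F)"
      by (intro image_eqI[of _ _ "\<lambda>k. z (k - 1)"]) auto
  qed auto
  then have "{z. \<forall>k<n. z k \<in> F} = (\<lambda>z k. z (Suc k)) ` ({1..n} \<rightarrow> F)" by simp
  then show ?thesis unfolding diameter_of_order_def v by (simp add: image_image)
qed

text \<open>Leja points give the lower bound for every \<open>n \<ge> 2\<close> without any loss. In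
  the upper bound the extra factor \<open>(n * D) powr (2 / (n - 1))\<close> tends to 1.\<close>

theorem diameter_of_order_tendsto:
  assumes "compact F" "F \<noteq> {}" "F \<subseteq> sphere 0 1"
  shows "(\<lambda>n. diameter_of_order n F) \<longlonglongrightarrow> chebyshev_constant F"
proof -
  let ?c = "chebyshev_constant F"
  have c0: "?c \<ge> 0" by (rule chebyshev_constant_nonneg[OF assms(3)])
  have pw: "(\<Prod>k<n. a ^ k) powr (2 / (real n * (real n - 1))) = a" if "n \<ge> 2" "a \<ge> 0" for n and a :: real
  proof (cases "a = 0")
    case True
    \<comment> \<open>The vanishing factor is the one for \<open>k = 1\<close>, as
      \<open>0 ^ 0 = 1\<close>; this is where \<open>n \<ge> 2\<close> enters.\<close>
    have "(\<Prod>k<n. a ^ k) = 0" using True that(1) by (intro prod_zero bexI[of _ 1]) auto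
    then show ?thesis using True by simp
  next
    case False
    have p: "(\<Prod>k<n. a ^ k) > 0" using False that by (intro prod_pos) auto
    let ?P = "(\<Prod>k<n. a ^ k)"
    have "?P powr (2 / (real n * (real n - 1))) = (?P powr 2) powr (1 / (real n * (real n - 1)))"
      by (simp add: powr_powr)
    also have "?P powr 2 = a ^ (n * (n - 1))" using p prod_power_lessThan[of a n] by simp
    also have "\<dots> = a powr (real n * (real n - 1))"
      using False that by (subst powr_realpow[symmetric]) (auto simp: of_nat_diff)
    also have "(a powr (real n * (real n - 1))) powr (1 / (real n * (real n - 1))) = a"
      using False that by (simp add: powr_powr)
    finally show ?thesis .
  qed
  have bound: "\<exists>D\<ge>1. \<forall>n\<ge>2. \<forall>z\<in>{z. \<forall>k<n. z k \<in> F}. 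
     vandermonde n z powr (2 / (real n * (real n - 1))) \<le> (real n * D) powr (2 / (real n - 1)) * r"
    if r: "r \<in> cheb_bounds F" for r
  proof -
    obtain D where D: "D \<ge> 1"
      "\<And>n z. (\<And>k. k < n \<Longrightarrow> z k \<in> F) \<Longrightarrow> vandermonde n z \<le> (real n * D) ^ n * (\<Prod>k<n. r ^ k)"
      using vandermonde_le_cheb_bound[OF assms(3) r] by blast
    have r0: "r > 0" using r cheb_bounds_pos by blast
    have "vandermonde n z powr (2 / (real n * (real n - 1))) \<le> (real n * D) powr (2 / (real n - 1)) * r"
      if "n \<ge> 2" "\<And>k. k < n \<Longrightarrow> z k \<in> F" for n z
    proof -
      have "vandermonde n z powr (2 / (real n * (real n - 1)))
          \<le> ((real n * D) ^ n * (\<Prod>k<n. r ^ k)) powr (2 / (real n * (real n - 1)))"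
        using that D by (intro powr_mono2 vandermonde_nonneg) auto
      also have "\<dots> = ((real n * D) ^ n) powr (2 / (real n * (real n - 1))) * r"
        using that D r0 by (subst powr_mult) (auto simp: pw intro!: prod_nonneg)
      also have "((real n * D) ^ n) = (real n * D) powr real n"
        using that D by (subst powr_realpow) auto
      also have "\<dots> powr (2 / (real n * (real n - 1))) = (real n * D) powr (2 / (real n - 1))"
        using that by (simp add: powr_powr)
      finally show ?thesis .
    qed
    then show ?thesis using D(1) by blast
  qed
  show ?thesis
  proof (rule order_tendstoI)
    fix a assume a: "a < ?c"
    have "diameter_of_order n F > a" if n: "n \<ge> 2" for n
    proof -
      obtain w where w: "\<And>k. w k \<in> F" "vandermonde n w \<ge> (\<Prod>k<n. ?c ^ k)"
        using vandermonde_lower[OF assms] by blast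
      \<comment> \<open>The trivial bound \<open>r = 1\<close> serves only to make the supremum
        finite.\<close>
      obtain D where "\<forall>z\<in>{z. \<forall>k<n. z k \<in> F}. 
         vandermonde n z powr (2 / (real n * (real n - 1))) \<le> (real n * D) powr (2 / (real n - 1)) * 1"
        using bound[OF one_in_cheb_bounds[OF assms(3)]] n by blast
      then have bdd: "bdd_above ((\<lambda>z. vandermonde n z powr (2 / (real n * (real n - 1)))) ` {z. \<forall>k<n. z k \<in> F})"
        by (intro bdd_aboveI2) blast
      have "?c = (\<Prod>k<n. ?c ^ k) powr (2 / (real n * (real n - 1)))" using pw n c0 by simp
      also have "\<dots> \<le> vandermonde n w powr (2 / (real n * (real n - 1)))"
        using n c0 w by (intro powr_mono2 prod_nonneg) auto
      also have "\<dots> \<le> diameter_of_order n F"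
        unfolding diameter_of_order_eq[OF n] using w by (intro cSUP_upper bdd) auto
      finally show ?thesis using a by simp
    qed
    then show "\<forall>\<^sub>F n in sequentially. a < diameter_of_order n F"
      using eventually_sequentially by blast
  next
    fix a assume "?c < a"
    then obtain r where r: "r \<in> cheb_bounds F" "r < a" using cheb_bounds_approx[OF assms(3)] by blast
    obtain D where D: "D \<ge> 1" "\<And>n z. n \<ge> 2 \<Longrightarrow> z \<in> {z. \<forall>k<n. z k \<in> F} \<Longrightarrow>
         vandermonde n z powr (2 / (real n * (real n - 1))) \<le> (real n * D) powr (2 / (real n - 1)) * r"
      using bound[OF r(1)] by blast
    obtain x where "x \<in> F" using assms by blast
    then have ne: "{z. \<forall>k<n. z k \<in> F} \<noteq> {}" for n :: nat by auto
    have le: "diameter_of_order n F \<le> (real n * D) powr (2 / (real n - 1)) * r" if "n \<ge> 2" for n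
      unfolding diameter_of_order_eq[OF that] using D(2)[OF that] ne by (intro cSUP_least) auto
    have "(\<lambda>n. (real n * D) powr (2 / (real n - 1))) \<longlonglongrightarrow> 1"
      using D(1) by real_asymp
    then have "(\<lambda>n. (real n * D) powr (2 / (real n - 1)) * r) \<longlonglongrightarrow> 1 * r"
      by (intro tendsto_intros)
    then have "\<forall>\<^sub>F n in sequentially. (real n * D) powr (2 / (real n - 1)) * r < a"
      using r(2) by (intro order_tendstoD) auto
    then show "\<forall>\<^sub>F n in sequentially. diameter_of_order n F < a"
      using eventually_ge_at_top[of 2] by eventually_elim (use le in force)
  qed
qed

subsection \<open>Transporting arcs into subsets of almost full measure\<close>

lemma cmod_cis_diff: "cmod (cis s - cis t) = 2 * \<bar>sin ((s - t) / 2)\<bar>"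
proof -
  have "cis s - cis t = cis ((s + t) / 2) * (cis ((s - t) / 2) - cis (- ((s - t) / 2)))"
    by (simp add: right_diff_distrib cis_mult) (simp add: field_simps)
  also have "cis ((s - t) / 2) - cis (- ((s - t) / 2)) = \<i> * of_real (2 * sin ((s - t) / 2))"
    by (simp add: complex_eq_iff)
  finally show ?thesis by (simp add: norm_mult)
qed

text \<open>Concavity on \<open>{0..pi}\<close> together with \<open>sin 0 = 0\<close> gives
  \<open>\<rho> * sin x \<le> sin (\<rho> * x)\<close>; then monotonicity up to
  \<open>pi / 2\<close> applies.\<close>

lemma sin_contraction:
  assumes "0 \<le> \<rho>" "\<rho> \<le> 1" "0 \<le> x" "x \<le> pi" "\<rho> * x \<le> y" "y \<le> pi / 2"
  shows "\<rho> * sin x \<le> sin y"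
proof -
  have "concave_on {0..pi} sin"
  proof (rule f''_le0_imp_concave)
    show "(sin has_real_derivative cos x) (at x)" for x by (auto intro!: derivative_eq_intros)
    show "(cos has_real_derivative - sin x) (at x)" for x by (auto intro!: derivative_eq_intros)
  qed (auto simp: sin_ge_zero)
  then have "(1 - \<rho>) * sin 0 + \<rho> * sin x \<le> sin ((1 - \<rho>) *\<^sub>R 0 + \<rho> *\<^sub>R x)"
    using assms by (intro concave_onD) auto
  then have "\<rho> * sin x \<le> sin (\<rho> * x)" by simp
  also have "\<dots> \<le> sin y"
    using assms by (intro sin_monotone_2pi_le) (auto intro: order_trans[of _ 0])
  finally show ?thesis .
qed

text \<open>The two hypotheses compare both arcs between the points, so whichever of them is the
  shorter one determines the chord.\<close>

lemma chord_contraction: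
  assumes "0 \<le> \<rho>" "\<rho> \<le> 1" "0 \<le> t - s" "t - s \<le> 2 * pi"
    and "\<rho> * (t - s) \<le> t' - s'" "\<rho> * (2 * pi - (t - s)) \<le> 2 * pi - (t' - s')"
  shows "\<rho> * cmod (cis s - cis t) \<le> cmod (cis s' - cis t')"
proof -
  define x y where "x = (t - s) / 2" and "y = (t' - s') / 2"
  have x: "0 \<le> x" "x \<le> pi" and y: "\<rho> * x \<le> y" "\<rho> * (pi - x) \<le> pi - y"
    using assms unfolding x_def y_def by (simp_all add: field_simps)
  have "0 \<le> \<rho> * x" "0 \<le> \<rho> * (pi - x)" using assms x by auto
  then have y0: "0 \<le> y" "y \<le> pi" using y by linarith+
  have "\<rho> * sin x \<le> sin y"
  \<comment> \<open>Beyond \<open>pi / 2\<close> the sine decreases, so the complementary half arcs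
    \<open>pi - x\<close> and \<open>pi - y\<close> are compared instead.\<close>
  proof (cases "y \<le> pi / 2")
    case True
    then show ?thesis using assms x y by (intro sin_contraction) auto
  next
    case False
    then have "\<rho> * sin (pi - x) \<le> sin (pi - y)" using assms x y by (intro sin_contraction) auto
    then show ?thesis by simp
  qed
  moreover have "cmod (cis s - cis t) = 2 * sin x"
    using x by (subst norm_minus_commute) (simp add: cmod_cis_diff x_def[symmetric] sin_ge_zero)
  moreover have "cmod (cis s' - cis t') = 2 * sin y"
    using y0 by (subst norm_minus_commute) (simp add: cmod_cis_diff y_def[symmetric] sin_ge_zero)
  ultimately show ?thesis by simp
qed

section \<open>The distribution function of Lebesgue measure on a compact set\<close>

lemma measure_lebesgue_subset_singleton: "A \<subseteq> {x :: real} \<Longrightarrow> measure lebesgue A = 0"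
  by (auto simp: subset_singleton_iff)

definition cumulative :: "real set \<Rightarrow> real \<Rightarrow> real" where
  "cumulative B x = measure lebesgue (B \<inter> {..x})"

lemma cumulative_split:
  assumes "compact B" "x \<le> y"
  shows "cumulative B y = cumulative B x + measure lebesgue (B \<inter> {x<..y})"
proof -
  have "B \<inter> {..x} \<in> lmeasurable"
    using assms by (intro lmeasurable_compact compact_Int_closed) auto
  moreover have "B \<inter> {x<..y} \<in> lmeasurable"
    using assms lmeasurable_compact by (intro fmeasurable_Int_fmeasurable) auto
  moreover have "B \<inter> {..y} = (B \<inter> {..x}) \<union> (B \<inter> {x<..y})" using assms by auto
  moreover have "(B \<inter> {..x}) \<inter> (B \<inter> {x<..y}) = {}" by auto
  ultimately show ?thesis unfolding cumulative_def
    by (simp add: measure_Un3)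
qed

lemma cumulative_mono: "compact B \<Longrightarrow> x \<le> y \<Longrightarrow> cumulative B x \<le> cumulative B y"
  by (simp add: cumulative_split[of B x y])

lemma cumulative_diff_le:
  assumes "compact B" "x \<le> y"
  shows "cumulative B y - cumulative B x \<le> y - x"
proof -
  have "B \<inter> {x<..y} \<in> lmeasurable"
    using assms lmeasurable_compact by (intro fmeasurable_Int_fmeasurable) auto
  then have "measure lebesgue (B \<inter> {x<..y}) \<le> measure lebesgue {x..y}"
    by (intro measure_mono_fmeasurable lmeasurable_compact) (auto simp: fmeasurableD)
  also have "\<dots> = y - x" using assms by simp
  finally show ?thesis using cumulative_split[OF assms] by simp
qed

lemma continuous_on_cumulative:
  assumes "compact B"
  shows "continuous_on A (cumulative B)"
proof (rule lipschitz_on_continuous_on[OF lipschitz_onI])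
  show "dist (cumulative B x) (cumulative B y) \<le> 1 * dist x y" for x y
    using cumulative_mono[OF assms, of x y] cumulative_mono[OF assms, of y x]
      cumulative_diff_le[OF assms, of x y] cumulative_diff_le[OF assms, of y x]
    by (cases "x \<le> y") (auto simp: dist_real_def)
qed simp

text \<open>The intermediate value theorem alone could give a point in a gap of \<open>B\<close>.
  The least point of \<open>B\<close> with value at least \<open>v\<close> works: if its value
  exceeded \<open>v\<close>, the part of \<open>B\<close> just to its left would have positive
  measure and contain a smaller candidate.\<close>

lemma cumulative_attains:
  assumes "compact B" "B \<noteq> {}" "0 \<le> v" "v \<le> measure lebesgue B"
  shows "\<exists>x\<in>B. cumulative B x = v"
proof -
  obtain top where top: "top \<in> B" "\<And>y. y \<in> B \<Longrightarrow> y \<le> top"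
    using compact_attains_sup[OF assms(1,2)] by blast
  obtain bot where bot: "bot \<in> B" "\<And>y. y \<in> B \<Longrightarrow> bot \<le> y"
    using compact_attains_inf[OF assms(1,2)] by blast
  have "B \<inter> {..top} = B" using top by auto
  then have ctop: "cumulative B top = measure lebesgue B" by (simp add: cumulative_def)
  have "B \<inter> {..bot} = {bot}" using bot by (auto intro: antisym)
  then have cbot: "cumulative B bot = 0" by (simp add: cumulative_def)
  let ?G = "B \<inter> {x. v \<le> cumulative B x}"
  have "compact ?G"
    using assms(1)
    by (intro compact_Int_closed closed_Collect_le continuous_on_cumulative continuous_on_const)
  moreover have "?G \<noteq> {}" using top ctop assms(4) by auto
  ultimately obtain x where x: "x \<in> B" "v \<le> cumulative B x"
    and least: "\<And>y. y \<in> B \<Longrightarrow> v \<le> cumulative B y \<Longrightarrow> x \<le> y"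
    using compact_attains_inf[of ?G] by auto
  have "cumulative B x = v"
  proof (rule ccontr)
    assume "cumulative B x \<noteq> v"
    then have gt: "v < cumulative B x" using x by simp
    then obtain u where u: "v < u" "u < cumulative B x" using dense by blast
    have "\<exists>y\<ge>bot. y \<le> x \<and> cumulative B y = u"
      using u assms(3) cbot bot x by (intro IVT' continuous_on_cumulative assms) auto
    then obtain y where y: "y \<le> x" "cumulative B y = u" by blast
    have "measure lebesgue (B \<inter> {y<..x}) > 0"
      using cumulative_split[OF assms(1) y(1)] y u by simp
    then have "\<not> B \<inter> {y<..x} \<subseteq> {x}"
      by (metis less_irrefl measure_lebesgue_subset_singleton)
    then obtain z where z: "z \<in> B" "y < z" "z < x" by force
    have "v \<le> cumulative B z" using cumulative_mono[OF assms(1), of y z] z y u by simp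
    then show False using least z by force
  qed
  then show ?thesis using x by blast
qed

text \<open>The point \<open>\<psi> t\<close> of \<open>B\<close> is chosen so that \<open>B \<inter> {a..\<psi> t}\<close> has measure proportional to
  \<open>t - a\<close>. Distances dominate measures, which gives all the estimates.\<close>

lemma transport_interval:
  assumes "compact B" "a < b" "0 < \<rho>" "\<rho> * (b - a) \<le> measure lebesgue (B \<inter> {a..b})"
  obtains \<psi> where "\<And>t. t \<in> {a..b} \<Longrightarrow> \<psi> t \<in> B \<inter> {a..b}"
    and "\<And>t. t \<in> {a..b} \<Longrightarrow> \<rho> * (t - a) \<le> \<psi> t - a"
    and "\<And>t. t \<in> {a..b} \<Longrightarrow> \<rho> * (b - t) \<le> b - \<psi> t"
    and "\<And>s t. s \<in> {a..b} \<Longrightarrow> t \<in> {a..b} \<Longrightarrow> s \<le> t \<Longrightarrow> \<rho> * (t - s) \<le> \<psi> t - \<psi> s"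
proof -
  define C where "C = B \<inter> {a..b}"
  \<comment> \<open>The exact density of \<open>C\<close> is used instead of the lower bound
    \<open>\<rho>\<close>, so that \<open>b\<close> corresponds to the full measure and the estimate
    at the right end mirrors the one at the left.\<close>
  define \<sigma> where "\<sigma> = measure lebesgue C / (b - a)"
  have C: "compact C" unfolding C_def using assms by (intro compact_Int_closed) auto
  have \<sigma>: "\<rho> \<le> \<sigma>" and \<sigma>ba: "\<sigma> * (b - a) = measure lebesgue C"
    unfolding \<sigma>_def C_def using assms by (auto simp: field_simps)
  have "0 < \<rho> * (b - a)" using assms by simp
  then have "measure lebesgue C > 0" unfolding C_def using assms(4) by linarith
  then have ne: "C \<noteq> {}" by auto
  have "\<exists>x\<in>C. cumulative C x = \<sigma> * (t - a)" if t: "t \<in> {a..b}" for t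
  proof (rule cumulative_attains[OF C ne])
    show "0 \<le> \<sigma> * (t - a)" using \<sigma> assms t by auto
    have "\<sigma> * (t - a) \<le> \<sigma> * (b - a)" using \<sigma> assms t by (intro mult_left_mono) auto
    then show "\<sigma> * (t - a) \<le> measure lebesgue C" using \<sigma>ba by simp
  qed
  then obtain \<psi> where \<psi>: "\<And>t. t \<in> {a..b} \<Longrightarrow> \<psi> t \<in> C"
    "\<And>t. t \<in> {a..b} \<Longrightarrow> cumulative C (\<psi> t) = \<sigma> * (t - a)" by metis
  have ca: "cumulative C a = 0"
  proof -
    have "C \<inter> {..a} \<subseteq> {a}" unfolding C_def by auto
    then show ?thesis unfolding cumulative_def by (rule measure_lebesgue_subset_singleton)
  qed
  have cb: "cumulative C b = \<sigma> * (b - a)"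
  proof -
    have "C \<inter> {..b} = C" unfolding C_def by auto
    then show ?thesis by (simp add: cumulative_def \<sigma>ba)
  qed
  have in_ab: "\<psi> t \<in> {a..b}" if "t \<in> {a..b}" for t using \<psi>(1)[OF that] C_def by auto
  have le: "\<rho> * d \<le> \<sigma> * d" if "d \<ge> 0" for d using that \<sigma> by (intro mult_right_mono) auto
  show ?thesis
  proof (rule that)
    fix t assume t: "t \<in> {a..b}"
    show "\<psi> t \<in> B \<inter> {a..b}" using \<psi>(1)[OF t] C_def by auto
    show "\<rho> * (t - a) \<le> \<psi> t - a"
      using cumulative_diff_le[OF C, of a "\<psi> t"] in_ab[OF t] \<psi>(2)[OF t] ca le[of "t - a"] t by auto
    show "\<rho> * (b - t) \<le> b - \<psi> t"
      using cumulative_diff_le[OF C, of "\<psi> t" b] in_ab[OF t] \<psi>(2)[OF t] cb le[of "b - t"] t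
      by (auto simp: algebra_simps)
  next
    fix s t assume st: "s \<in> {a..b}" "t \<in> {a..b}" "s \<le> t"
    have eq: "cumulative C (\<psi> t) - cumulative C (\<psi> s) = \<sigma> * (t - s)"
      by (simp add: \<psi>(2)[OF st(1)] \<psi>(2)[OF st(2)] algebra_simps)
    show "\<rho> * (t - s) \<le> \<psi> t - \<psi> s"
    proof (cases "\<psi> s \<le> \<psi> t")
      case True
      then show ?thesis using cumulative_diff_le[OF C True] eq le[of "t - s"] st by linarith
    next
      case False
      \<comment> \<open>A reversal of order is possible only for \<open>s = t\<close>, since
        \<open>\<sigma>\<close> is positive.\<close>
      then have "\<sigma> * (t - s) \<le> 0" using cumulative_mono[OF C, of "\<psi> t" "\<psi> s"] eq by simp
      then have "t = s" using \<sigma> assms(3) st by (simp add: mult_le_0_iff)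
      then show ?thesis by simp
    qed
  qed
qed

text \<open>Since \<open>\<psi>\<close> also controls the distances to the end points, points of different intervals can be
  compared through the end points between them, even if the intervals touch or meet across \<open>\<pi>\<close>.\<close>

lemma transport_arcs:
  assumes "compact B" "0 < \<rho>" "\<rho> \<le> 1"
    and "\<And>i. i \<in> I \<Longrightarrow> a i < b i \<and> -pi \<le> a i \<and> b i \<le> pi"
    and "\<And>i j. i \<in> I \<Longrightarrow> j \<in> I \<Longrightarrow> i \<noteq> j \<Longrightarrow> b i \<le> a j \<or> b j \<le> a i"
    and "\<And>i. i \<in> I \<Longrightarrow> \<rho> * (b i - a i) \<le> measure lebesgue (B \<inter> {a i..b i})"
  obtains \<Psi> where "\<And>z. z \<in> (\<Union>i\<in>I. cis ` {a i..b i}) \<Longrightarrow> \<Psi> z \<in> cis ` B"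
    and "\<And>z w. z \<in> (\<Union>i\<in>I. cis ` {a i..b i}) \<Longrightarrow> w \<in> (\<Union>i\<in>I. cis ` {a i..b i}) \<Longrightarrow>
           \<rho> * cmod (z - w) \<le> cmod (\<Psi> z - \<Psi> w)"
proof -
  have "\<exists>\<psi>. (\<forall>t\<in>{a i..b i}. \<psi> t \<in> B \<inter> {a i..b i} \<and> \<rho> * (t - a i) \<le> \<psi> t - a i \<and>
          \<rho> * (b i - t) \<le> b i - \<psi> t) \<and>
        (\<forall>s\<in>{a i..b i}. \<forall>t\<in>{a i..b i}. s \<le> t \<longrightarrow> \<rho> * (t - s) \<le> \<psi> t - \<psi> s)" if "i \<in> I" for i
    using transport_interval[of B "a i" "b i" \<rho>] assms(1,2,4,6) that by metis
  then have "\<forall>i\<in>I. \<exists>\<psi>. (\<forall>t\<in>{a i..b i}. \<psi> t \<in> B \<inter> {a i..b i} \<and> \<rho> * (t - a i) \<le> \<psi> t - a i \<and>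
          \<rho> * (b i - t) \<le> b i - \<psi> t) \<and>
        (\<forall>s\<in>{a i..b i}. \<forall>t\<in>{a i..b i}. s \<le> t \<longrightarrow> \<rho> * (t - s) \<le> \<psi> t - \<psi> s)"
    by blast
  from bchoice[OF this] obtain \<psi> where \<psi>: "\<And>i t. i \<in> I \<Longrightarrow> t \<in> {a i..b i} \<Longrightarrow> \<psi> i t \<in> B \<inter> {a i..b i}"
    "\<And>i t. i \<in> I \<Longrightarrow> t \<in> {a i..b i} \<Longrightarrow> \<rho> * (t - a i) \<le> \<psi> i t - a i"
    "\<And>i t. i \<in> I \<Longrightarrow> t \<in> {a i..b i} \<Longrightarrow> \<rho> * (b i - t) \<le> b i - \<psi> i t"
    "\<And>i s t. i \<in> I \<Longrightarrow> s \<in> {a i..b i} \<Longrightarrow> t \<in> {a i..b i} \<Longrightarrow> s \<le> t \<Longrightarrow>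
       \<rho> * (t - s) \<le> \<psi> i t - \<psi> i s"
    by blast
  have shrink: "\<rho> * d \<le> d" if "0 \<le> d" for d :: real
    using that assms(3) mult_right_mono[of \<rho> 1 d] by simp
  have ordered: "\<rho> * cmod (cis s - cis t) \<le> cmod (cis (\<psi> i s) - cis (\<psi> j t))"
    if "i \<in> I" "j \<in> I" "s \<in> {a i..b i}" "t \<in> {a j..b j}" "i = j \<and> s \<le> t \<or> b i \<le> a j" for i j s t
  proof (rule chord_contraction)
    have ab: "-pi \<le> a i" "b j \<le> pi" using assms(4) that by auto
    \<comment> \<open>The complementary arc runs from \<open>t\<close> across \<open>pi\<close> to
      \<open>s\<close>. It consists of two pieces inside the intervals, controlled by the end point
      estimates, and two pieces outside, whose lengths stay fixed.\<close>
    have "\<rho> * (s - a i) \<le> \<psi> i s - a i" "\<rho> * (a i + pi) \<le> a i + pi"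
      "\<rho> * (b j - t) \<le> b j - \<psi> j t" "\<rho> * (pi - b j) \<le> pi - b j"
      using \<psi> shrink ab that by auto
    then show "\<rho> * (2 * pi - (t - s)) \<le> 2 * pi - (\<psi> j t - \<psi> i s)" by (simp add: algebra_simps)
    show "\<rho> * (t - s) \<le> \<psi> j t - \<psi> i s"
    proof (cases "b i \<le> a j")
      case True
      have "\<rho> * (b i - s) \<le> b i - \<psi> i s" "\<rho> * (t - a j) \<le> \<psi> j t - a j"
        "\<rho> * (a j - b i) \<le> a j - b i" using \<psi> shrink True that by auto
      then show ?thesis by (simp add: algebra_simps)
    next
      case False
      then show ?thesis using \<psi>(4) that by auto
    qed
    show "0 \<le> t - s" "t - s \<le> 2 * pi" using that ab by auto
  qed (use assms in auto)
  have pairs: "\<rho> * cmod (cis s - cis t) \<le> cmod (cis (\<psi> i s) - cis (\<psi> j t))"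
    if "i \<in> I" "j \<in> I" "s \<in> {a i..b i}" "t \<in> {a j..b j}" for i j s t
  proof -
    have "(i = j \<and> s \<le> t \<or> b i \<le> a j) \<or> (j = i \<and> t \<le> s \<or> b j \<le> a i)"
      using assms(5)[OF that(1,2)] by fastforce
    then show ?thesis
    proof (elim disjE[of "i = j \<and> s \<le> t \<or> b i \<le> a j"])
      assume 1: "i = j \<and> s \<le> t \<or> b i \<le> a j"
      then show ?thesis using ordered that by blast
    next
      assume 2: "j = i \<and> t \<le> s \<or> b j \<le> a i"
      then show ?thesis using ordered[of j i t s] that by (simp add: norm_minus_commute)
    qed
  qed
  have "\<exists>i t. i \<in> I \<and> t \<in> {a i..b i} \<and> z = cis t" if "z \<in> (\<Union>i\<in>I. cis ` {a i..b i})" for z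
    using that by blast
  \<comment> \<open>A point can lie on two arcs or have both parameters \<open>pi\<close> and
    \<open>-pi\<close>. Any choice will do, because \<open>pairs\<close> holds for all
    parameters.\<close>
  then obtain \<iota> \<tau> where rep: "\<And>z. z \<in> (\<Union>i\<in>I. cis ` {a i..b i}) \<Longrightarrow>
      \<iota> z \<in> I \<and> \<tau> z \<in> {a (\<iota> z)..b (\<iota> z)} \<and> z = cis (\<tau> z)" by metis
  show ?thesis
  proof (rule that[of "\<lambda>z. cis (\<psi> (\<iota> z) (\<tau> z))"])
    fix z assume "z \<in> (\<Union>i\<in>I. cis ` {a i..b i})"
    then show "cis (\<psi> (\<iota> z) (\<tau> z)) \<in> cis ` B" using rep \<psi>(1) by blast
  next
    fix z w assume "z \<in> (\<Union>i\<in>I. cis ` {a i..b i})" "w \<in> (\<Union>i\<in>I. cis ` {a i..b i})"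
    then show "\<rho> * cmod (z - w) \<le> cmod (cis (\<psi> (\<iota> z) (\<tau> z)) - cis (\<psi> (\<iota> w) (\<tau> w)))"
      using pairs[of "\<iota> z" "\<iota> w" "\<tau> z" "\<tau> w"] rep by metis
  qed
qed

text \<open>Configurations of points are transported rather than polynomials. The images of Leja
  points of the arcs lose at most a factor \<open>\<rho>\<close> per distance, and
  \<open>le_cheb_bound\<close> converts their products into a bound for the Chebyshev
  constant.\<close>

lemma chebyshev_constant_arcs_le:
  assumes "compact B" "0 < \<rho>" "\<rho> \<le> 1" "finite I"
    and "\<And>i. i \<in> I \<Longrightarrow> a i < b i \<and> -pi \<le> a i \<and> b i \<le> pi"
    and "\<And>i j. i \<in> I \<Longrightarrow> j \<in> I \<Longrightarrow> i \<noteq> j \<Longrightarrow> b i \<le> a j \<or> b j \<le> a i"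
    and "\<And>i. i \<in> I \<Longrightarrow> \<rho> * (b i - a i) \<le> measure lebesgue (B \<inter> {a i..b i})"
  shows "\<rho> * chebyshev_constant (\<Union>i\<in>I. cis ` {a i..b i}) \<le> chebyshev_constant (cis ` B)"
proof -
  define F where "F = (\<Union>i\<in>I. cis ` {a i..b i})"
  have F: "compact F" "F \<subseteq> sphere 0 1"
    unfolding F_def using assms(4)
    by (auto intro!: compact_UN compact_continuous_image continuous_intros)
  have B: "cis ` B \<subseteq> sphere 0 1" by auto
  obtain \<Psi> where \<Psi>: "\<And>z. z \<in> F \<Longrightarrow> \<Psi> z \<in> cis ` B"
      "\<And>z w. z \<in> F \<Longrightarrow> w \<in> F \<Longrightarrow> \<rho> * cmod (z - w) \<le> cmod (\<Psi> z - \<Psi> w)"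
  proof (rule transport_arcs[OF assms(1-3), of I a b, folded F_def])
    show "a i < b i \<and> -pi \<le> a i \<and> b i \<le> pi" if "i \<in> I" for i by (rule assms(5)[OF that])
    show "b i \<le> a j \<or> b j \<le> a i" if "i \<in> I" "j \<in> I" "i \<noteq> j" for i j by (rule assms(6)[OF that])
    show "\<rho> * (b i - a i) \<le> measure lebesgue (B \<inter> {a i..b i})" if "i \<in> I" for i
      by (rule assms(7)[OF that])
  qed blast
  have "\<rho> * chebyshev_constant F \<le> chebyshev_constant (cis ` B)"
  proof (cases "F = {}")
    case True
    then show ?thesis by (simp add: chebyshev_constant_empty chebyshev_constant_nonneg[OF B])
  next
    case False
    have "\<rho> * chebyshev_constant F \<le> r" if r: "r \<in> cheb_bounds (cis ` B)" for r
    proof (rule le_cheb_bound[OF B r])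
      show "0 \<le> \<rho> * chebyshev_constant F"
        using assms(2) chebyshev_constant_nonneg[OF F(2)] by auto
      fix n
      obtain w where w: "\<And>k. w k \<in> F" "vandermonde n w \<ge> (\<Prod>k<n. chebyshev_constant F ^ k)"
        using vandermonde_lower[OF F(1) False F(2)] by blast
      have "(\<Prod>k<n. (\<rho> * chebyshev_constant F) ^ k) = (\<Prod>k<n. \<rho> ^ k) * (\<Prod>k<n. chebyshev_constant F ^ k)"
        by (simp add: power_mult_distrib prod.distrib)
      also have "\<dots> \<le> (\<Prod>k<n. \<rho> ^ k) * vandermonde n w"
        using assms(2) w by (intro mult_left_mono prod_nonneg) auto
      also have "\<dots> = (\<Prod>k<n. \<Prod>j<k. \<rho> * cmod (w j - w k))"
        unfolding vandermonde_def by (simp add: prod.distrib)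
      also have "\<dots> \<le> vandermonde n (\<lambda>k. \<Psi> (w k))"
        unfolding vandermonde_def using assms(2) w \<Psi> by (intro prod_mono conjI prod_nonneg) auto
      finally have "vandermonde n (\<lambda>k. \<Psi> (w k)) \<ge> (\<Prod>k<n. (\<rho> * chebyshev_constant F) ^ k)" .
      moreover have "\<forall>k<n. \<Psi> (w k) \<in> cis ` B" using \<Psi>(1)[OF w(1)] by simp
      ultimately show "\<exists>z. (\<forall>k<n. z k \<in> cis ` B) \<and> vandermonde n z \<ge> (\<Prod>k<n. (\<rho> * chebyshev_constant F) ^ k)"
        by (intro exI[of _ "\<lambda>k. \<Psi> (w k)"] conjI)
    qed
    then show ?thesis
      unfolding chebyshev_constant_def[of "cis ` B"] using one_in_cheb_bounds[OF B]
      by (intro cInf_greatest) auto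
  qed
  then show ?thesis by (simp add: F_def)
qed

section \<open>Finite unions of intervals\<close>

text \<open>Every component contains a whole member of \<open>I\<close>, hence the point selected
  from that member, and is determined by this point.\<close>

lemma finite_components_Union:
  assumes "finite I" "\<And>J. J \<in> I \<Longrightarrow> connected J \<and> J \<noteq> {}"
  shows "finite (components (\<Union>I))"
proof -
  have "components (\<Union>I) \<subseteq> (\<lambda>J. connected_component_set (\<Union>I) (SOME x. x \<in> J)) ` I"
  proof
    fix C assume "C \<in> components (\<Union>I)"
    then obtain x where x: "x \<in> \<Union>I" "C = connected_component_set (\<Union>I) x"
      by (auto simp: components_def)
    then obtain J where J: "J \<in> I" "x \<in> J" by blast
    have "(SOME x. x \<in> J) \<in> J" using someI[of "\<lambda>x. x \<in> J", OF J(2)] .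
    then have "(SOME x. x \<in> J) \<in> connected_component_set (\<Union>I) x"
      using J assms(2) by (auto simp: connected_component_def intro!: exI[of _ J])
    then have "C = connected_component_set (\<Union>I) (SOME x. x \<in> J)"
      using x connected_component_eq by metis
    then show "C \<in> (\<lambda>J. connected_component_set (\<Union>I) (SOME x. x \<in> J)) ` I" using J by blast
  qed
  then show ?thesis using assms(1) finite_surj by blast
qed

text \<open>Members of \<open>I\<close> may overlap, whereas the components of the union are
  disjoint intervals. Those with interior form the family \<open>\<N>\<close>, represented by their
  end points; the one-point components go into \<open>P\<close>.\<close>

lemma finite_Union_intervals_decompose:
  fixes I :: "real set set"
  assumes "finite I" "\<And>J. J \<in> I \<Longrightarrow> is_interval J \<and> J \<noteq> {}" "\<Union>I \<subseteq> {l..u}"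
  obtains \<N> :: "real set set" and P where "finite \<N>" "finite P"
    "\<And>C. C \<in> \<N> \<Longrightarrow> Inf C < Sup C \<and> l \<le> Inf C \<and> Sup C \<le> u"
    "\<And>C. C \<in> \<N> \<Longrightarrow> {Inf C<..<Sup C} \<subseteq> \<Union>I"
    "\<And>C D. C \<in> \<N> \<Longrightarrow> D \<in> \<N> \<Longrightarrow> C \<noteq> D \<Longrightarrow> Sup C \<le> Inf D \<or> Sup D \<le> Inf C"
    "\<Union>I \<subseteq> (\<Union>C\<in>\<N>. {Inf C..Sup C}) \<union> P"
proof -
  let ?\<C> = "components (\<Union>I)"
  have fin: "finite ?\<C>"
    using assms by (intro finite_components_Union) (auto simp: is_interval_connected_1)
  have C: "C \<noteq> {}" "is_interval C" "C \<subseteq> \<Union>I" "bdd_below C" "bdd_above C" "C \<subseteq> {l..u}" if "C \<in> ?\<C>" for C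
  proof -
    show "C \<noteq> {}" "is_interval C" "C \<subseteq> \<Union>I"
      using in_components_nonempty[OF that] in_components_connected[OF that]
        in_components_subset[OF that] by (simp_all add: is_interval_connected_1)
    then show "C \<subseteq> {l..u}" using assms(3) by blast
    then show "bdd_below C" "bdd_above C" by (meson bdd_below_Icc bdd_below_mono bdd_above_Icc bdd_above_mono)+
  qed
  have inside: "C \<subseteq> {Inf C..Sup C}" if "C \<in> ?\<C>" for C
    using C[OF that] by (auto intro: cInf_lower cSup_upper)
  have interior: "{Inf C<..<Sup C} \<subseteq> C" if "C \<in> ?\<C>" for C
  proof
    note C' = C[OF that]
    fix x assume x: "x \<in> {Inf C<..<Sup C}"
    obtain y where y: "y \<in> C" "y < x" using x cInf_lessD[of C x] C' by auto
    obtain z where z: "z \<in> C" "x < z" using x less_cSupD[of C x] C' by auto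
    show "x \<in> C" using C'(2) y z unfolding is_interval_1 by (meson less_imp_le)
  qed
  have bounds: "l \<le> Inf C" "Sup C \<le> u" if "C \<in> ?\<C>" for C
    using C(1,6)[OF that] by (auto intro!: cInf_greatest cSup_least)
  define \<N> where "\<N> = {C \<in> ?\<C>. Inf C < Sup C}"
  define P where "P = Inf ` {C \<in> ?\<C>. \<not> Inf C < Sup C}"
  have single: "C = {Inf C}" if "C \<in> ?\<C>" "\<not> Inf C < Sup C" for C
  proof -
    have "x = Inf C" if "x \<in> C" for x
      using inside[OF \<open>C \<in> ?\<C>\<close>] \<open>\<not> Inf C < Sup C\<close> that by fastforce
    then show ?thesis using C(1)[OF that(1)] by blast
  qed
  show ?thesis
  proof (rule that[of \<N> P])
    show "finite \<N>" "finite P" using fin unfolding \<N>_def P_def by auto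
    show "Inf C < Sup C \<and> l \<le> Inf C \<and> Sup C \<le> u" if "C \<in> \<N>" for C
      using that bounds unfolding \<N>_def by auto
    show "{Inf C<..<Sup C} \<subseteq> \<Union>I" if "C \<in> \<N>" for C
      using that interior C(3) unfolding \<N>_def by blast
    show "\<Union>I \<subseteq> (\<Union>C\<in>\<N>. {Inf C..Sup C}) \<union> P"
    proof
      fix x assume "x \<in> \<Union>I"
      then obtain D where D: "D \<in> ?\<C>" "x \<in> D" by (metis UnionE Union_components)
      show "x \<in> (\<Union>C\<in>\<N>. {Inf C..Sup C}) \<union> P"
      proof (cases "Inf D < Sup D")
        case True
        then have "D \<in> \<N>" using D(1) unfolding \<N>_def by simp
        then show ?thesis using inside[OF D(1)] D(2) by blast
      next
        case False
        then have "x = Inf D" using single[OF D(1)] D(2) by blast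
        then show ?thesis using False D(1) unfolding P_def by blast
      qed
    qed
    show "Sup C \<le> Inf D \<or> Sup D \<le> Inf C" if "C \<in> \<N>" "D \<in> \<N>" "C \<noteq> D" for C D
    proof (rule ccontr)
      assume "\<not> ?thesis"
      then have "max (Inf C) (Inf D) < min (Sup C) (Sup D)"
        using that unfolding \<N>_def by auto
      then obtain x where "max (Inf C) (Inf D) < x" "x < min (Sup C) (Sup D)" using dense by blast
      moreover have CD: "C \<in> ?\<C>" "D \<in> ?\<C>" using that unfolding \<N>_def by auto
      ultimately have "x \<in> C" "x \<in> D" using interior[OF CD(1)] interior[OF CD(2)] by auto
      then show False using that components_nonoverlap[of C "\<Union>I" D] unfolding \<N>_def by auto
    qed
  qed
qed

subsection \<open>The prediction error\<close>

definition weighted_norm2 :: "(real \<Rightarrow> real) \<Rightarrow> complex poly \<Rightarrow> real" where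
  "weighted_norm2 f q = (LINT t:{-pi..pi}|lebesgue. (cmod (poly q (cis t)))\<^sup>2 * f t)"

lemma prediction_error_eq:
  "prediction_error n f = sqrt (INF q\<in>monic_polys n. weighted_norm2 f q)"
  by (simp add: prediction_error_def weighted_norm2_def)

lemma monic_polys_nonempty: "monic_polys n \<noteq> {}"
  using monic_polys_power[OF linear_in_monic_polys[of 0], of n] by auto

lemma continuous_on_cmod_poly_cis: "continuous_on A (\<lambda>t. cmod (poly q (cis t)))"
  by (intro continuous_intros)

context
  fixes f :: "real \<Rightarrow> real"
  assumes f_int: "set_integrable lebesgue {-pi..pi} f"
    and f_nonneg: "\<And>t. t \<in> {-pi..pi} \<Longrightarrow> 0 \<le> f t"
begin

text \<open>The polynomial factor is continuous, hence bounded by some \<open>M\<close> on the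
  interval, and \<open>M * f\<close> dominates. Integrability ensures that the integrals below are
  not the default value 0.\<close>

lemma set_integrable_poly_weight:
  "set_integrable lebesgue {-pi..pi} (\<lambda>t. (cmod (poly q (cis t)))\<^sup>2 * f t)"
proof -
  let ?g = "\<lambda>t. (cmod (poly q (cis t)))\<^sup>2"
  have "continuous_on {-pi..pi} ?g" by (intro continuous_intros)
  then have "compact (?g ` {-pi..pi})" by (intro compact_continuous_image) auto
  then obtain M where M: "\<And>t. t \<in> {-pi..pi} \<Longrightarrow> \<bar>?g t\<bar> \<le> M"
    by (meson compact_imp_bounded bounded_real imageI)
  have meas: "?g \<in> borel_measurable lebesgue"
  proof (rule measurable_completion)
    have "continuous_on UNIV ?g" by (intro continuous_intros)
    then show "?g \<in> borel_measurable lborel"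
      using borel_measurable_continuous_onI by simp
  qed
  show ?thesis unfolding set_integrable_def
  proof (rule Bochner_Integration.integrable_bound)
    show "integrable lebesgue (\<lambda>t. M * (indicator {-pi..pi} t *\<^sub>R f t))"
      using f_int unfolding set_integrable_def by (rule integrable_mult_right)
    have "(\<lambda>t. ?g t * (indicator {-pi..pi} t *\<^sub>R f t)) \<in> borel_measurable lebesgue"
      using f_int unfolding set_integrable_def
      by (intro borel_measurable_times meas borel_measurable_integrable)
    then show "(\<lambda>t. indicator {-pi..pi} t *\<^sub>R (?g t * f t)) \<in> borel_measurable lebesgue"
      by (simp add: mult.left_commute)
    show "AE t in lebesgue. norm (indicator {-pi..pi} t *\<^sub>R (?g t * f t))
        \<le> norm (M * (indicator {-pi..pi} t *\<^sub>R f t))"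
    proof (rule AE_I2)
      fix t
      show "norm (indicator {-pi..pi} t *\<^sub>R (?g t * f t)) \<le> norm (M * (indicator {-pi..pi} t *\<^sub>R f t))"
      proof (cases "t \<in> {-pi..pi}")
        case True
        then have "?g t * \<bar>f t\<bar> \<le> \<bar>M\<bar> * \<bar>f t\<bar>"
          using M[OF True] by (intro mult_right_mono) auto
        then show ?thesis using True by (simp add: abs_mult)
      qed simp
    qed
  qed
qed

section \<open>Upper bound for the prediction error by trial polynomials\<close>

lemma weighted_norm2_nonneg: "weighted_norm2 f q \<ge> 0"
  unfolding weighted_norm2_def set_lebesgue_integral_def
  by (intro Bochner_Integration.integral_nonneg) (auto simp: indicator_def intro!: f_nonneg mult_nonneg_nonneg)

lemma prediction_error_le:
  assumes "q \<in> monic_polys n"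
  shows "prediction_error n f \<le> sqrt (weighted_norm2 f q)"
  unfolding prediction_error_eq
  by (intro real_sqrt_le_mono cINF_lower assms bdd_belowI2[of _ 0] weighted_norm2_nonneg)

lemma prediction_error_nonneg: "prediction_error n f \<ge> 0"
  unfolding prediction_error_eq
  by (intro real_sqrt_ge_zero cINF_greatest monic_polys_nonempty weighted_norm2_nonneg)

text \<open>Where \<open>f\<close> vanishes the size of \<open>q\<close> is irrelevant, so a bound
  on the unclosed spectrum suffices.\<close>

lemma weighted_norm2_le:
  assumes "\<And>z. z \<in> spectrum_on_circle f \<Longrightarrow> cmod (poly q z) \<le> K"
  shows "weighted_norm2 f q \<le> K\<^sup>2 * (LINT t:{-pi..pi}|lebesgue. f t)"
proof -
  have "weighted_norm2 f q \<le> (LINT t:{-pi..pi}|lebesgue. K\<^sup>2 * f t)"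
    unfolding weighted_norm2_def
  proof (rule set_integral_mono[OF set_integrable_poly_weight])
    show "set_integrable lebesgue {-pi..pi} (\<lambda>t. K\<^sup>2 * f t)" using f_int by simp
    fix t assume t: "t \<in> {-pi..pi}"
    show "(cmod (poly q (cis t)))\<^sup>2 * f t \<le> K\<^sup>2 * f t"
    proof (cases "f t > 0")
      case True
      then have "cmod (poly q (cis t)) \<le> K"
        using t assms by (auto simp: spectrum_on_circle_def spectral_support_def)
      then show ?thesis using True by (intro mult_right_mono power_mono) auto
    next
      case False
      then show ?thesis using f_nonneg[OF t] by simp
    qed
  qed
  then show ?thesis by simp
qed

lemma root_prediction_error_upper:
  assumes "chebyshev_constant (spectrum_on_circle f) < x"
  shows "\<forall>\<^sub>F n in sequentially. root n (prediction_error n f) < x"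
proof -
  have sub: "spectrum_on_circle f \<subseteq> sphere 0 1" by (auto simp: spectrum_on_circle_def)
  obtain r where r: "r \<in> cheb_bounds (spectrum_on_circle f)" "r < x"
    using cheb_bounds_approx[OF sub assms] by blast
  have r0: "r > 0" using r cheb_bounds_pos by blast
  obtain D where D: "D \<ge> 1"
    "\<And>k. \<exists>q\<in>monic_polys k. \<forall>z\<in>spectrum_on_circle f. cmod (poly q z) \<le> D * r ^ k"
    using cheb_bounds_all_degrees[OF sub r(1)] by blast
  define T where "T = (LINT t:{-pi..pi}|lebesgue. f t)"
  have T0: "T \<ge> 0" unfolding T_def set_lebesgue_integral_def
    by (intro Bochner_Integration.integral_nonneg) (auto simp: indicator_def intro!: f_nonneg)
  \<comment> \<open>Adding 1 makes \<open>C\<close> positive even if \<open>T = 0\<close>, as needed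
    for \<open>root n C\<close> to tend to 1.\<close>
  define C where "C = D * sqrt T + 1"
  have C: "C > 0" unfolding C_def using D(1) T0 by (simp add: add_nonneg_pos)
  have le: "root n (prediction_error n f) \<le> root n C * r" if n: "n > 0" for n
  proof -
    obtain q where q: "q \<in> monic_polys n" "\<And>z. z \<in> spectrum_on_circle f \<Longrightarrow> cmod (poly q z) \<le> D * r ^ n"
      using D(2) by blast
    have "prediction_error n f \<le> sqrt ((D * r ^ n)\<^sup>2 * T)"
      using prediction_error_le[OF q(1)] weighted_norm2_le[OF q(2)] unfolding T_def
      by (meson order_trans real_sqrt_le_mono)
    also have "\<dots> = D * sqrt T * r ^ n" using D(1) r0 by (simp add: real_sqrt_mult)
    also have "\<dots> \<le> C * r ^ n" unfolding C_def using r0 by (intro mult_right_mono) auto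
    finally have "root n (prediction_error n f) \<le> root n (C * r ^ n)" using n by simp
    also have "\<dots> = root n C * r" using n r0 by (simp add: real_root_mult real_root_power_cancel)
    finally show ?thesis .
  qed
  have "(\<lambda>n. root n C * r) \<longlonglongrightarrow> 1 * r"
    by (intro tendsto_mult LIMSEQ_root_const C tendsto_const)
  then have "\<forall>\<^sub>F n in sequentially. root n C * r < x" using r(2) by (intro order_tendstoD) auto
  then show ?thesis
    using eventually_gt_at_top[of 0] by eventually_elim (blast intro: le_less_trans[OF le])
qed

section \<open>Lower bound for the prediction error\<close>

text \<open>The level sets of \<open>f\<close> at heights \<open>1 / (k + 1)\<close> exhaust the
  support, so one of them misses measure less than \<open>e / 2\<close>. Inner regularity by closed
  sets costs another \<open>e / 2\<close>.\<close>

lemma weight_bounded_below: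
  assumes "e > 0"
  obtains \<eta> A where "\<eta> > 0" "compact A" "A \<subseteq> spectral_support f" "\<And>t. t \<in> A \<Longrightarrow> \<eta> \<le> f t"
    "spectral_support f - A \<in> lmeasurable" "measure lebesgue (spectral_support f - A) \<le> e"
proof -
  let ?S = "spectral_support f"
  \<comment> \<open>Cutting \<open>f\<close> off keeps all level sets at positive heights inside the
    interval.\<close>
  let ?h = "\<lambda>t. indicator {-pi..pi} t *\<^sub>R f t"
  have h: "?h \<in> borel_measurable lebesgue"
    using f_int unfolding set_integrable_def by (rule borel_measurable_integrable)
  have S_eq: "?S = {t \<in> space lebesgue. 0 < ?h t}"
    by (auto simp: spectral_support_def indicator_def split: if_splits)
  have S: "?S \<in> lmeasurable"
  proof (rule bounded_set_imp_lmeasurable)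
    show "bounded ?S" by (rule bounded_subset[of "{-pi..pi}"]) (auto simp: spectral_support_def)
    show "?S \<in> sets lebesgue" unfolding S_eq using h by measurable
  qed
  define L where "L = (\<lambda>k. {t \<in> space lebesgue. 1 / real (Suc k) \<le> ?h t})"
  have L: "L k \<in> sets lebesgue" for k unfolding L_def using h by measurable
  have LS: "L k \<subseteq> ?S" for k
  proof
    fix t assume "t \<in> L k"
    then have "1 / real (Suc k) \<le> ?h t" by (simp add: L_def)
    moreover have "0 < 1 / real (Suc k)" by simp
    ultimately have "0 < ?h t" by linarith
    then show "t \<in> ?S" unfolding S_eq by simp
  qed
  have "(\<lambda>k. measure lebesgue (?S - L k)) \<longlonglongrightarrow> measure lebesgue (\<Inter>k. ?S - L k)"
  proof (rule Lim_measure_decseq)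
    show "range (\<lambda>k. ?S - L k) \<subseteq> sets lebesgue" using S L by (auto simp: fmeasurableD)
    show "decseq (\<lambda>k. ?S - L k)"
    proof (rule decseq_SucI)
      fix k
      have "1 / real (Suc (Suc k)) \<le> 1 / real (Suc k)" by (intro divide_left_mono) auto
      then have "L k \<subseteq> L (Suc k)" unfolding L_def by (auto intro: order_trans)
      then show "?S - L (Suc k) \<subseteq> ?S - L k" by blast
    qed
    show "emeasure lebesgue (?S - L k) \<noteq> \<infinity>" for k
      using fmeasurable_Diff[OF S L[of k]] by (auto simp: fmeasurable_def)
  qed
  moreover have "(\<Inter>k. ?S - L k) = {}"
  proof -
    have "\<exists>k. t \<in> L k" if "t \<in> ?S" for t
    proof -
      have "0 < ?h t" using that S_eq by auto
      then obtain k where "inverse (real (Suc k)) < ?h t" using reals_Archimedean by blast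
      then show ?thesis unfolding L_def by (auto simp: inverse_eq_divide intro!: exI[of _ k])
    qed
    then show ?thesis by blast
  qed
  ultimately have "(\<lambda>k. measure lebesgue (?S - L k)) \<longlonglongrightarrow> 0"
    by (simp only: measure_empty)
  then have "\<forall>\<^sub>F k in sequentially. measure lebesgue (?S - L k) < e / 2"
    using assms by (intro order_tendstoD) auto
  then obtain k where k: "measure lebesgue (?S - L k) < e / 2" by (auto simp: eventually_sequentially)
  obtain A where A: "closed A" "A \<subseteq> L k" "L k - A \<in> lmeasurable" "emeasure lebesgue (L k - A) < ennreal (e / 2)"
    using sets_lebesgue_inner_closed[OF L, of "e / 2" k] assms by auto
  have mA: "measure lebesgue (L k - A) \<le> e / 2"
    using A(3,4) assms by (simp add: emeasure_eq_measure2 ennreal_less_iff)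
  show ?thesis
  proof (rule that)
    show "1 / real (Suc k) > 0" by simp
    show AS: "A \<subseteq> ?S" using A LS by blast
    then have "A \<subseteq> {-pi..pi}" by (auto simp: spectral_support_def)
    then have "bounded A" using bounded_subset bounded_closed_interval by blast
    then show "compact A" using A(1) compact_eq_bounded_closed by blast
    then have "A \<in> sets lebesgue" using lmeasurable_compact fmeasurableD by blast
    then show "?S - A \<in> lmeasurable" using S by (intro fmeasurable_Diff)
    show "1 / real (Suc k) \<le> f t" if "t \<in> A" for t
    proof -
      have "t \<in> L k" "t \<in> {-pi..pi}" using that A AS by (auto simp: spectral_support_def)
      then show ?thesis by (simp add: L_def)
    qed
    have "?S - A = (?S - L k) \<union> (L k - A)" using A LS by blast
    then have "measure lebesgue (?S - A) \<le> measure lebesgue (?S - L k) + measure lebesgue (L k - A)"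
      using measure_Un_le[of "?S - L k" lebesgue "L k - A"] A(3) S L by (auto simp: fmeasurableD)
    then show "measure lebesgue (?S - A) \<le> e" using k mA by simp
  qed
qed

text \<open>The constant does not depend on \<open>n\<close>, because \<open>A\<close>,
  \<open>\<eta>\<close> and \<open>\<epsilon>\<close> are fixed before the polynomial is chosen. It
  therefore disappears under the n-th root.\<close>

lemma prediction_error_lower:
  assumes "finite I" "\<And>J. J \<in> I \<Longrightarrow> is_interval J \<and> J \<noteq> {}" "spectral_support f = \<Union>I"
    and \<rho>: "0 < \<rho>" "\<rho> < 1"
  obtains \<kappa> where "\<kappa> > 0"
    "\<And>n. n > 0 \<Longrightarrow> \<kappa> * (\<rho> * chebyshev_constant (closure (spectrum_on_circle f))) ^ n \<le> prediction_error n f"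
proof -
  let ?S = "spectral_support f" and ?E = "spectrum_on_circle f"
  have S: "?S \<subseteq> {-pi..pi}" by (auto simp: spectral_support_def)
  obtain \<N> :: "real set set" and P where \<N>: "finite \<N>" "finite P"
    "\<And>C. C \<in> \<N> \<Longrightarrow> Inf C < Sup C \<and> -pi \<le> Inf C \<and> Sup C \<le> pi"
    "\<And>C. C \<in> \<N> \<Longrightarrow> {Inf C<..<Sup C} \<subseteq> ?S"
    "\<And>C D. C \<in> \<N> \<Longrightarrow> D \<in> \<N> \<Longrightarrow> C \<noteq> D \<Longrightarrow> Sup C \<le> Inf D \<or> Sup D \<le> Inf C"
    "?S \<subseteq> (\<Union>C\<in>\<N>. {Inf C..Sup C}) \<union> P"
  proof (rule finite_Union_intervals_decompose[of I "-pi" pi, folded assms(3)])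
    show "is_interval J \<and> J \<noteq> {}" if "J \<in> I" for J by (rule assms(2)[OF that])
  qed (use assms(1) S in blast)+
  define F where "F = (\<Union>C\<in>\<N>. cis ` {Inf C..Sup C})"
  let ?c = "chebyshev_constant F"
  have F: "compact F" "F \<subseteq> sphere 0 1"
    unfolding F_def using \<N>(1) by (auto intro!: compact_UN compact_continuous_image continuous_on_cis continuous_on_id)
  \<comment> \<open>The full closed arcs and finitely many points cover the closed spectrum, and the
    points do not raise the Chebyshev constant.\<close>
  have cle: "chebyshev_constant (closure ?E) \<le> ?c"
  proof -
    have "?E \<subseteq> F \<union> cis ` P" using \<N>(6) unfolding F_def spectrum_on_circle_def by blast
    then have "closure ?E \<subseteq> F \<union> cis ` P"
      by (rule closure_minimal) (use F \<N>(2) in \<open>simp add: closed_Un compact_imp_closed finite_imp_closed\<close>)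
    then have "chebyshev_constant (closure ?E) \<le> chebyshev_constant (F \<union> cis ` P)"
      using F by (intro chebyshev_constant_mono) auto
    also have "\<dots> \<le> ?c" using F \<N>(2) by (intro chebyshev_constant_Un_finite) auto
    finally show ?thesis .
  qed
  have c0: "chebyshev_constant (closure ?E) \<ge> 0"
  proof (rule chebyshev_constant_nonneg)
    show "closure ?E \<subseteq> sphere 0 1" by (rule closure_minimal) (auto simp: spectrum_on_circle_def)
  qed
  \<comment> \<open>Two exceptional sets of measure at most \<open>\<epsilon>\<close> will occur,
    and together they may take up a share \<open>1 - \<rho>\<close> of the shortest interval.
    Inserting 1 keeps \<open>Min\<close> meaningful when \<open>\<N>\<close> is empty.\<close>
  define \<epsilon> where "\<epsilon> = (1 - \<rho>) * Min (insert 1 ((\<lambda>C. Sup C - Inf C) ` \<N>)) / 2"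
  have Mpos: "Min (insert 1 ((\<lambda>C. Sup C - Inf C) ` \<N>)) > 0" using \<N>(1,3) by (subst Min_gr_iff) auto
  then have \<epsilon>: "\<epsilon> > 0" unfolding \<epsilon>_def using \<rho> by simp
  have \<epsilon>_le: "2 * \<epsilon> \<le> (1 - \<rho>) * (Sup C - Inf C)" if "C \<in> \<N>" for C
  proof -
    have "Min (insert 1 ((\<lambda>C. Sup C - Inf C) ` \<N>)) \<le> Sup C - Inf C"
      using that \<N>(1) by (intro Min_le) auto
    then show ?thesis unfolding \<epsilon>_def using \<rho> by simp
  qed
  obtain \<eta> A where A: "\<eta> > 0" "compact A" "A \<subseteq> ?S" "\<And>t. t \<in> A \<Longrightarrow> \<eta> \<le> f t"
    "?S - A \<in> lmeasurable" "measure lebesgue (?S - A) \<le> \<epsilon>"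
    using weight_bounded_below[OF \<epsilon>] by blast
  have key: "(\<rho> * ?c) ^ n \<le> K"
    if n: "n > 0" and q: "q \<in> monic_polys n" and K: "K > 0" "weighted_norm2 f q \<le> \<eta> * \<epsilon> * K\<^sup>2" for n q K
  proof -
    define B where "B = A \<inter> {t. cmod (poly q (cis t)) \<le> K}"
    have B: "compact B" unfolding B_def
      by (intro compact_Int_closed A closed_Collect_le continuous_on_cmod_poly_cis continuous_on_const)
    \<comment> \<open>On \<open>A\<close> the weight is at least \<open>\<eta>\<close>, so
      \<open>|q| > K\<close> forces a point into this level set, whose measure Markov's inequality
      bounds by \<open>\<epsilon>\<close>.\<close>
    let ?X = "{t \<in> {-pi..pi}. \<eta> * K\<^sup>2 \<le> (cmod (poly q (cis t)))\<^sup>2 * f t}"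
    have X_lm: "?X \<in> lmeasurable"
    proof (rule bounded_set_imp_lmeasurable)
      show "bounded ?X" by (rule bounded_subset[of "{-pi..pi}"]) auto
      let ?h = "\<lambda>t. indicator {-pi..pi} t *\<^sub>R ((cmod (poly q (cis t)))\<^sup>2 * f t)"
      have "?h \<in> borel_measurable lebesgue"
        using set_integrable_poly_weight[of q] unfolding set_integrable_def by (rule borel_measurable_integrable)
      then have "{t \<in> space lebesgue. \<eta> * K\<^sup>2 \<le> ?h t} \<in> sets lebesgue" by measurable
      moreover have "{t \<in> space lebesgue. \<eta> * K\<^sup>2 \<le> ?h t} = ?X"
        using A(1) K(1) by (auto simp: indicator_def split: if_splits)
          (auto simp: mult_le_0_iff)
      ultimately show "?X \<in> sets lebesgue" by simp
    qed
    have "measure lebesgue ?X \<le> (LINT t:{-pi..pi}|lebesgue. (cmod (poly q (cis t)))\<^sup>2 * f t) / (\<eta> * K\<^sup>2)"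
      using A(1) K(1) f_nonneg
      by (intro integral_Markov_inequality'_measure set_integrable_poly_weight AE_I2) auto
    also have "\<dots> \<le> \<epsilon>"
      using K A(1) unfolding weighted_norm2_def by (simp add: divide_le_eq mult_ac)
    finally have X: "measure lebesgue ?X \<le> \<epsilon>" .
    have "A - B \<subseteq> ?X"
    proof
      fix t assume t: "t \<in> A - B"
      then have "K \<le> cmod (poly q (cis t))" "\<eta> \<le> f t" "t \<in> {-pi..pi}"
        using A(3,4) S unfolding B_def by auto
      then have "\<eta> * K\<^sup>2 \<le> f t * (cmod (poly q (cis t)))\<^sup>2"
        using K(1) A(1) by (intro mult_mono power_mono) auto
      then show "t \<in> ?X" using \<open>t \<in> {-pi..pi}\<close> by (simp add: mult.commute)
    qed
    then have SB: "?S \<subseteq> B \<union> (?S - A) \<union> ?X" by blast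
    have "\<rho> * ?c \<le> chebyshev_constant (cis ` B)"
      unfolding F_def
    proof (rule chebyshev_constant_arcs_le[OF B \<rho>(1) less_imp_le[OF \<rho>(2)] \<N>(1,3,5)])
      fix C assume C: "C \<in> \<N>"
      have "{Inf C<..<Sup C} \<subseteq> (B \<inter> {Inf C..Sup C}) \<union> ((?S - A) \<union> ?X)"
        using \<N>(4)[OF C] SB by force
      moreover have BC: "B \<inter> {Inf C..Sup C} \<in> lmeasurable"
        using B by (intro lmeasurable_compact compact_Int_closed) auto
      ultimately have "measure lebesgue {Inf C<..<Sup C}
          \<le> measure lebesgue ((B \<inter> {Inf C..Sup C}) \<union> ((?S - A) \<union> ?X))"
        using A(5) X_lm by (intro measure_mono_fmeasurable fmeasurable.Un) auto
      also have "\<dots> \<le> measure lebesgue (B \<inter> {Inf C..Sup C}) + measure lebesgue ((?S - A) \<union> ?X)"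
        using BC A(5) X_lm by (intro measure_Un_le) (auto simp: fmeasurableD)
      finally have "measure lebesgue {Inf C<..<Sup C}
          \<le> measure lebesgue (B \<inter> {Inf C..Sup C}) + measure lebesgue ((?S - A) \<union> ?X)" .
      moreover have "measure lebesgue ((?S - A) \<union> ?X) \<le> measure lebesgue (?S - A) + measure lebesgue ?X"
        using A(5) X_lm by (intro measure_Un_le) (auto simp: fmeasurableD)
      moreover have "measure lebesgue {Inf C<..<Sup C} = Sup C - Inf C" using \<N>(3)[OF C] by simp
      ultimately have "Sup C - Inf C \<le> measure lebesgue (B \<inter> {Inf C..Sup C}) + 2 * \<epsilon>"
        using A(6) X by linarith
      then show "\<rho> * (Sup C - Inf C) \<le> measure lebesgue (B \<inter> {Inf C..Sup C})"
        using \<epsilon>_le[OF C] by (simp add: algebra_simps)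
    qed
    moreover have "chebyshev_constant (cis ` B) \<le> root n K"
      using n K(1) by (intro chebyshev_constant_le cheb_boundsI[OF _ _ q]) (auto simp: B_def)
    ultimately have "\<rho> * ?c \<le> root n K" by simp
    then have "(\<rho> * ?c) ^ n \<le> root n K ^ n"
      using \<rho>(1) c0 cle by (intro power_mono) auto
    then show ?thesis using n K(1) by simp
  qed
  have main: "sqrt (\<eta> * \<epsilon>) * (\<rho> * ?c) ^ n \<le> prediction_error n f" if n: "n > 0" for n
    unfolding prediction_error_eq
  proof (rule real_le_rsqrt, rule cINF_greatest[OF monic_polys_nonempty])
    fix q assume q: "q \<in> monic_polys n"
    define N where "N = weighted_norm2 f q"
    have N: "N \<ge> 0" unfolding N_def by (rule weighted_norm2_nonneg)
    have pos: "\<eta> * \<epsilon> > 0" using A(1) \<epsilon> by simp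
    have "(\<rho> * ?c) ^ n \<le> sqrt (N / (\<eta> * \<epsilon>))"
    \<comment> \<open>Approaching the root from above makes \<open>K\<close> positive even if
      \<open>N = 0\<close>, as \<open>key\<close> requires.\<close>
    proof (rule dense_ge)
      fix K assume K: "sqrt (N / (\<eta> * \<epsilon>)) < K"
      have "0 \<le> sqrt (N / (\<eta> * \<epsilon>))" using N pos by simp
      then have K0: "K > 0" using K by linarith
      have "N / (\<eta> * \<epsilon>) \<le> K\<^sup>2" using K K0 by (intro sqrt_le_D) simp
      then have "N \<le> \<eta> * \<epsilon> * K\<^sup>2" using pos by (simp add: divide_le_eq mult.commute)
      then show "(\<rho> * ?c) ^ n \<le> K" using key[OF n q K0] N_def by simp
    qed
    then have "((\<rho> * ?c) ^ n)\<^sup>2 \<le> (sqrt (N / (\<eta> * \<epsilon>)))\<^sup>2"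
      using \<rho>(1) c0 cle by (intro power_mono) auto
    also have "\<dots> = N / (\<eta> * \<epsilon>)" using N pos by simp
    finally have "\<eta> * \<epsilon> * ((\<rho> * ?c) ^ n)\<^sup>2 \<le> N" using pos by (simp add: le_divide_eq mult.commute)
    then show "(sqrt (\<eta> * \<epsilon>) * (\<rho> * ?c) ^ n)\<^sup>2 \<le> weighted_norm2 f q"
      using pos by (simp add: power_mult_distrib N_def)
  qed
  show ?thesis
  proof (rule that)
    show "sqrt (\<eta> * \<epsilon>) > 0" using A(1) \<epsilon> by simp
    fix n :: nat assume n: "n > 0"
    have "sqrt (\<eta> * \<epsilon>) * (\<rho> * chebyshev_constant (closure ?E)) ^ n \<le> sqrt (\<eta> * \<epsilon>) * (\<rho> * ?c) ^ n"
      using A(1) \<epsilon> \<rho>(1) c0 cle by (intro mult_left_mono power_mono) auto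
    then show "sqrt (\<eta> * \<epsilon>) * (\<rho> * chebyshev_constant (closure ?E)) ^ n \<le> prediction_error n f"
      using main[OF n] by simp
  qed
qed

lemma root_prediction_error_lower:
  assumes "finite I" "\<And>J. J \<in> I \<Longrightarrow> is_interval J \<and> J \<noteq> {}" "spectral_support f = \<Union>I"
    and "x < chebyshev_constant (closure (spectrum_on_circle f))"
  shows "\<forall>\<^sub>F n in sequentially. x < root n (prediction_error n f)"
proof (cases "x < 0")
  case True
  have "x < root n (prediction_error n f)" if "n > 0" for n
    using True real_root_ge_zero[OF prediction_error_nonneg[of n], of n] by linarith
  then show ?thesis by (intro eventually_sequentiallyI[of 1]) simp
next
  case False
  let ?c = "chebyshev_constant (closure (spectrum_on_circle f))"
  have c: "?c > 0" using False assms(4) by linarith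
  have "x / ?c < 1" using assms(4) c by simp
  \<comment> \<open>Exceeding the quotient gives \<open>x < \<rho> * ?c\<close>; the maximum with 0
    ensures \<open>\<rho> > 0\<close> when \<open>x = 0\<close>.\<close>
  then obtain \<rho> where \<rho>: "max (x / ?c) 0 < \<rho>" "\<rho> < 1" using dense[of "max (x / ?c) 0" 1] by auto
  obtain \<kappa> where \<kappa>: "\<kappa> > 0" "\<And>n. n > 0 \<Longrightarrow> \<kappa> * (\<rho> * ?c) ^ n \<le> prediction_error n f"
    using prediction_error_lower[OF assms(1-3), of \<rho>] \<rho> by auto
  have x\<rho>: "x < \<rho> * ?c" using \<rho>(1) c by (simp add: divide_less_eq)
  have le: "root n \<kappa> * (\<rho> * ?c) \<le> root n (prediction_error n f)" if n: "n > 0" for n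
  proof -
    have "root n (\<kappa> * (\<rho> * ?c) ^ n) \<le> root n (prediction_error n f)" using \<kappa>(2)[OF n] n by simp
    then show ?thesis using n \<rho>(1) c by (simp add: real_root_mult real_root_power_cancel)
  qed
  have "(\<lambda>n. root n \<kappa> * (\<rho> * ?c)) \<longlonglongrightarrow> 1 * (\<rho> * ?c)"
    by (intro tendsto_mult LIMSEQ_root_const \<kappa> tendsto_const)
  then have "\<forall>\<^sub>F n in sequentially. x < root n \<kappa> * (\<rho> * ?c)" using x\<rho> by (intro order_tendstoD) auto
  then show ?thesis
    using eventually_gt_at_top[of 0] by eventually_elim (blast intro: less_le_trans[OF _ le])
qed

end

theorem theorem3p1:
  fixes f :: "real \<Rightarrow> real" and I :: "real set set"
  assumes "set_integrable lebesgue {-pi..pi} f"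
    and "\<And>t. t \<in> {-pi..pi} \<Longrightarrow> 0 \<le> f t"
    and "finite I" and "I \<noteq> {}"
    and "\<And>J. J \<in> I \<Longrightarrow> is_interval J \<and> J \<noteq> {}"
    and "spectral_support f = \<Union>I"
  shows "(\<lambda>n. root n (prediction_error n f))
           \<longlonglongrightarrow> transfinite_diameter (closure (spectrum_on_circle f))"
proof -
  let ?E = "spectrum_on_circle f"
  have E: "?E \<subseteq> closure ?E" "closure ?E \<subseteq> sphere 0 1"
    by (rule closure_subset, rule closure_minimal) (auto simp: spectrum_on_circle_def)
  have "compact (closure ?E)"
    using E(2) bounded_subset[OF bounded_sphere] by (auto simp: compact_eq_bounded_closed)
  moreover have "closure ?E \<noteq> {}"
    using assms(4-6) by (auto simp: spectrum_on_circle_def)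
  ultimately have "(\<lambda>n. diameter_of_order n (closure ?E)) \<longlonglongrightarrow> chebyshev_constant (closure ?E)"
    using E(2) by (intro diameter_of_order_tendsto)
  then have eq: "transfinite_diameter (closure ?E) = chebyshev_constant (closure ?E)"
    unfolding transfinite_diameter_def by (rule limI)
  show ?thesis unfolding eq
  proof (rule order_tendstoI)
    fix x assume "x < chebyshev_constant (closure ?E)"
    then show "\<forall>\<^sub>F n in sequentially. x < root n (prediction_error n f)"
      using assms by (intro root_prediction_error_lower[of f I]) auto
  next
    fix x assume "chebyshev_constant (closure ?E) < x"
    then show "\<forall>\<^sub>F n in sequentially. root n (prediction_error n f) < x"
      \<comment> \<open>The upper estimate concerns the spectrum without its closure, whose
        Chebyshev constant is no larger.\<close>
      using chebyshev_constant_mono[OF E] by (intro root_prediction_error_upper assms) auto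
  qed
qed

end
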